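(* Let $\mathcal{M},\mathcal{L}\in\mathbb{C}^{2n\times2n}$ be such that $(\mathcal{M},\mathcal{L})$ is a regular symplectic pair with $\mathrm{ind}_\infty(\mathcal{M},\mathcal{L})\le 1$. Then there is an integer $\hat n\le n$ with $\mathrm{rank}(\mathcal{M})=\mathrm{rank}(\mathcal{L})=n+\hat n$. Moreover, with $\ell=n-\hat n$, there exist $U_0,U_\infty\in\mathbb{C}^{2n\times\ell}$, $U_1\in\mathbb{C}^{2n\times 2\hat n}$ and a symplectic matrix $\widehat{\mathcal{S}}\in\mathbb{C}^{2\hat n\times2\hat n}$ such that, with $\mathbf{U}=[U_1\,|\,U_0,U_\infty]\in\mathbb{C}^{2n\times 2n}$, $$\mathbf{U}^H\mathcal{J}_n\mathbf{U}=\begin{bmatrix}\mathcal{J}_{\hat n}&0\\0&\mathcal{J}_\ell\end{bmatrix}$$ and $$\mathcal{M}U_0=0,\qquad \mathcal{L}U_\infty=0,\qquad \mathcal{M}U_1=\mathcal{L}U_1\widehat{\mathcal{S}}.$$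
   Context: $\mathcal{J}_m=\begin{bmatrix}0&I_m\\-I_m&0\end{bmatrix}$ (absent if $m=0$). A matrix $\mathcal{S}\in\mathbb{C}^{2m\times2m}$ is symplectic if $\mathcal{S}\mathcal{J}_m\mathcal{S}^H=\mathcal{J}_m$. A pair $(\mathcal{M},\mathcal{L})$ of $2n\times2n$ matrices is symplectic if $\mathcal{M}\mathcal{J}_n\mathcal{M}^H=\mathcal{L}\mathcal{J}_n\mathcal{L}^H$, and regular if $\det(\mathcal{M}-\lambda\mathcal{L})\ne0$ for some $\lambda\in\mathbb{C}$. For a regular pair $(A,B)$ there are invertible $P,Q$ with $PAQ=\mathrm{diag}(J,I)$, $PBQ=\mathrm{diag}(I,N)$ where $J$ is a Jordan matrix and $N$ is nilpotent (Kronecker canonical form); $\mathrm{ind}_\infty(A,B)$ is the nilpotency index of $N$ (the least $\nu$ with $N^\nu=0$), and by convention $\mathrm{ind}_\infty(A,B)=0$ if $B$ is invertible. *)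

theory Defs
  imports "Jordan_Normal_Form.Jordan_Normal_Form" "Jordan_Normal_Form.Schur_Decomposition"
    "Jordan_Normal_Form.DL_Rank"
begin

definition Jmat :: "nat \<Rightarrow> complex mat" where
  "Jmat m = four_block_mat (0\<^sub>m m m) (1\<^sub>m m) (- 1\<^sub>m m) (0\<^sub>m m m)"

definition symplectic_mat :: "nat \<Rightarrow> complex mat \<Rightarrow> bool" where
  "symplectic_mat m S \<longleftrightarrow> S \<in> carrier_mat (2*m) (2*m) \<and> S * Jmat m * mat_adjoint S = Jmat m"

definition symplectic_pair :: "nat \<Rightarrow> complex mat \<Rightarrow> complex mat \<Rightarrow> bool" where
  "symplectic_pair n M L \<longleftrightarrow> M * Jmat n * mat_adjoint M = L * Jmat n * mat_adjoint L"

definition regular_pair :: "complex mat \<Rightarrow> complex mat \<Rightarrow> bool" where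
  "regular_pair M L \<longleftrightarrow> (\<exists>z::complex. det (M - z \<cdot>\<^sub>m L) \<noteq> 0)"

text \<open>Index at infinity via the Kronecker canonical form P A Q = diag(J, I), P B Q = diag(I, N),
  J a Jordan matrix (of size k), N nilpotent (of size d - k); the index is the nilpotency
  index of N (least nu with N^nu = 0), which is 0 when the N-block is empty (B invertible).\<close>
definition ind_inf :: "complex mat \<Rightarrow> complex mat \<Rightarrow> nat" where
  "ind_inf A B = (LEAST \<nu>. \<exists>P Q js N.
     (let d = dim_row A; k = sum_list (map fst js) in
       P \<in> carrier_mat d d \<and> Q \<in> carrier_mat d d \<and> invertible_mat P \<and> invertible_mat Q \<and>
       k \<le> d \<and> N \<in> carrier_mat (d - k) (d - k) \<and>
       P * A * Q = four_block_mat (jordan_matrix js) (0\<^sub>m k (d - k)) (0\<^sub>m (d - k) k) (1\<^sub>m (d - k)) \<and>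
       P * B * Q = four_block_mat (1\<^sub>m k) (0\<^sub>m k (d - k)) (0\<^sub>m (d - k) k) N \<and>
       N ^\<^sub>m \<nu> = 0\<^sub>m (d - k) (d - k)))"

definition hcat :: "complex mat \<Rightarrow> complex mat \<Rightarrow> complex mat" where
  "hcat A B = four_block_mat A B (0\<^sub>m 0 (dim_col A)) (0\<^sub>m 0 (dim_col B))"

end

theory Submission
  imports Defs "Jordan_Normal_Form.Jordan_Normal_Form_Existence"
begin

text \<open>
  Write \<open>J\<close> for \<open>Jmat n\<close>. From \<open>M J M\<^sup>H = L J L\<^sup>H\<close> and regularity, \<open>J L\<^sup>H\<close> maps the left kernel of \<open>M\<close>
  bijectively onto \<open>ker L\<close>, and symmetrically for \<open>J M\<^sup>H\<close>; hence the ranks agree and both kernels are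
  isotropic for the form given by \<open>J\<close>. A vector of \<open>ker L\<close> orthogonal to \<open>ker M\<close> has its \<open>M\<close>-image in the range of
  \<open>L\<close>, which index at most one forbids, so the two kernels are dually paired and span a hyperbolic
  subspace. Extending \<open>ker M\<close> to a Lagrangian subspace yields a symplectic basis \<open>U1\<close> of the orthogonal
  complement. That complement consists of the \<open>x\<close> with \<open>M x\<close> in the range of \<open>L\<close> and \<open>L x\<close> in the range of
  \<open>M\<close>, which gives \<open>M U1 = L U1 S\<close>; expanding \<open>J\<close> in the basis and cancelling the injective
  \<open>L U1\<close> shows that \<open>S\<close> is symplectic.
\<close>

notation mat_adjoint ("_\<^sup>H" [1000] 999)

text \<open>The matrix ring laws are restated with dimension equations as premises instead of membership in
  \<open>carrier_mat\<close>, since the simplifier can discharge the former without guessing dimensions.\<close>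

lemma mult_assoc_dim:
  fixes A :: "'a :: semiring_0 mat"
  assumes "dim_col A = dim_row B" "dim_col B = dim_row C"
  shows "A * B * C = A * (B * C)"
  by (rule assoc_mult_mat[of A "dim_row A" "dim_row B" B "dim_row C" C "dim_col C"])
    (use assms in auto)

lemma add_mult_dim:
  fixes A :: "'a :: semiring_0 mat"
  assumes "dim_row A = dim_row B" "dim_col A = dim_col B" "dim_col B = dim_row C"
  shows "(A + B) * C = A * C + B * C"
  by (rule add_mult_distrib_mat[of A "dim_row B" "dim_row C" B C "dim_col C"])
    (use assms in auto)

lemma mult_add_dim:
  fixes A :: "'a :: semiring_0 mat"
  assumes "dim_row B = dim_row C" "dim_col B = dim_col C" "dim_col A = dim_row C"
  shows "A * (B + C) = A * B + A * C"
  by (rule mult_add_distrib_mat[of A "dim_row A" "dim_row C" B "dim_col C" C])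
    (use assms in auto)

lemma one_mult_dim:
  fixes A :: "'a :: semiring_1 mat"
  shows "dim_row A = n \<Longrightarrow> 1\<^sub>m n * A = A" "dim_col A = n \<Longrightarrow> A * 1\<^sub>m n = A"
  using left_mult_one_mat[of A n "dim_col A"] right_mult_one_mat[of A "dim_row A" n] by blast+

lemma zero_mult_dim:
  fixes A :: "'a :: semiring_0 mat"
  shows "dim_row A = n \<Longrightarrow> 0\<^sub>m m n * A = 0\<^sub>m m (dim_col A)"
    "dim_col A = n \<Longrightarrow> A * 0\<^sub>m n m = 0\<^sub>m (dim_row A) m"
  using left_mult_zero_mat[of A n "dim_col A" m] right_mult_zero_mat[of A "dim_row A" n m] by blast+

lemma zero_add_dim:
  fixes A :: "'a :: monoid_add mat"
  shows "dim_row A = m \<Longrightarrow> dim_col A = n \<Longrightarrow> 0\<^sub>m m n + A = A"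
    "dim_row A = m \<Longrightarrow> dim_col A = n \<Longrightarrow> A + 0\<^sub>m m n = A"
  using left_add_zero_mat[of A m n] right_add_zero_mat[of A m n] by blast+

lemma add_assoc_dim:
  fixes A :: "'a :: monoid_add mat"
  assumes "dim_row A = dim_row B" "dim_col A = dim_col B" "dim_row B = dim_row C" "dim_col B = dim_col C"
  shows "A + B + C = A + (B + C)"
  using assms by (intro eq_matI) (auto simp: add.assoc)

lemma add_comm_dim:
  fixes A :: "'a :: ab_group_add mat"
  assumes "dim_row A = dim_row B" "dim_col A = dim_col B"
  shows "A + B = B + A"
  using assms by (intro eq_matI) (auto simp: add.commute)

lemma add_left_comm_dim:
  fixes A :: "'a :: ab_group_add mat"
  assumes "dim_row A = dim_row B" "dim_col A = dim_col B" "dim_row B = dim_row C" "dim_col B = dim_col C"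
  shows "A + (B + C) = B + (A + C)"
  using assms by (intro eq_matI) (auto simp: algebra_simps)

lemma add_uminus_dim:
  fixes A :: "'a :: ab_group_add mat"
  shows "A + - A = 0\<^sub>m (dim_row A) (dim_col A)" "- A + A = 0\<^sub>m (dim_row A) (dim_col A)"
    "dim_row A = dim_row B \<Longrightarrow> dim_col A = dim_col B \<Longrightarrow> A + (- A + B) = B"
    "dim_row A = dim_row B \<Longrightarrow> dim_col A = dim_col B \<Longrightarrow> - A + (A + B) = B"
    "dim_row A = dim_row B \<Longrightarrow> dim_col A = dim_col B \<Longrightarrow> - (A + B) = - A + - B"
    "- 0\<^sub>m m n = (0\<^sub>m m n :: 'a mat)"
  by (auto intro!: eq_matI)

lemma diff_dim:
  fixes A :: "'a :: ab_group_add mat"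
  assumes "dim_row A = dim_row B" "dim_col A = dim_col B"
  shows "A - B = A + - B"
  using assms by (intro eq_matI) auto

lemma uminus_mult_dim:
  fixes A :: "'a :: ring mat"
  assumes "dim_col A = dim_row B"
  shows "- A * B = - (A * B)" "A * - B = - (A * B)"
  using assms by auto

lemma smult_mult_dim:
  fixes A :: "'a :: comm_ring_1 mat"
  assumes "dim_col A = dim_row B"
  shows "(c \<cdot>\<^sub>m A) * B = c \<cdot>\<^sub>m (A * B)" "A * (c \<cdot>\<^sub>m B) = c \<cdot>\<^sub>m (A * B)"
  by (rule mult_smult_assoc_mat[of A "dim_row A" "dim_row B" B "dim_col B"]; use assms in auto)
    (rule mult_smult_distrib[of A "dim_row A" "dim_row B" B "dim_col B"]; use assms in auto)

lemmas mat_alg = mult_assoc_dim add_mult_dim mult_add_dim one_mult_dim zero_mult_dim zero_add_dim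
  add_assoc_dim add_comm_dim add_left_comm_dim add_uminus_dim diff_dim uminus_mult_dim

text \<open>Since \<open>mult_assoc_dim\<close> nests products to the right,
  \<open>A * B = E\<close> no longer matches inside a longer product; this form does, and the next
  lemma treats three factors.\<close>

lemma mult2_eq_left:
  fixes A :: "'a :: semiring_0 mat"
  assumes "A * B = E" "dim_col A = dim_row B" "dim_col B = dim_row X"
  shows "A * (B * X) = E * X"
  using assms(2-) unfolding assms(1)[symmetric] by (simp add: mult_assoc_dim)

lemma mult3_eq_left:
  fixes A :: "'a :: semiring_0 mat"
  assumes "A * (B * C) = E" "dim_col A = dim_row B" "dim_col B = dim_row C" "dim_col C = dim_row X"
  shows "A * (B * (C * X)) = E * X"
  using assms(2-) unfolding assms(1)[symmetric] by (simp add: mult_assoc_dim)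

section \<open>Conjugate transposes and concatenation of columns\<close>

lemma adjoint_dim [simp]: "dim_row (A\<^sup>H) = dim_col A" "dim_col (A\<^sup>H) = dim_row A"
  by (auto simp: mat_adjoint_def)

lemma adjoint_index [simp]:
  "i < dim_col A \<Longrightarrow> j < dim_row A \<Longrightarrow> A\<^sup>H $$ (i, j) = conjugate (A $$ (j, i))"
  by (auto simp: mat_adjoint_def mat_of_rows_def)

lemma adjoint_mult_dim:
  fixes A :: "complex mat"
  assumes "dim_col A = dim_row B"
  shows "(A * B)\<^sup>H = B\<^sup>H * A\<^sup>H"
  using assms by (intro eq_matI) (auto simp: scalar_prod_def mult.commute)

lemma adjoint_add_dim:
  fixes A :: "complex mat"
  assumes "dim_row A = dim_row B" "dim_col A = dim_col B"
  shows "(A + B)\<^sup>H = A\<^sup>H + B\<^sup>H"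
  using assms by (intro eq_matI) auto

lemma adjoint_simps [simp]:
  "(A\<^sup>H)\<^sup>H = (A :: complex mat)" "(- A)\<^sup>H = - ((A :: complex mat)\<^sup>H)" "(1\<^sub>m n)\<^sup>H = (1\<^sub>m n :: complex mat)"
  "(0\<^sub>m m n)\<^sup>H = (0\<^sub>m n m :: complex mat)" "(c \<cdot>\<^sub>m (A :: complex mat))\<^sup>H = cnj c \<cdot>\<^sub>m A\<^sup>H"
  by (auto intro!: eq_matI)

lemmas adj_alg = adjoint_mult_dim adjoint_add_dim

lemma hcat_dim [simp]: "dim_row (hcat A B) = dim_row A" "dim_col (hcat A B) = dim_col A + dim_col B"
  by (auto simp: hcat_def)

lemma hcat_index [simp]:
  assumes "i < dim_row A" "j < dim_col A + dim_col B"
  shows "hcat A B $$ (i, j) = (if j < dim_col A then A $$ (i, j) else B $$ (i, j - dim_col A))"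
  using assms by (auto simp: hcat_def)

lemma mult_hcat:
  assumes "dim_col Z = dim_row A" "dim_row A = dim_row B"
  shows "Z * hcat A B = hcat (Z * A) (Z * B)"
  using assms by (intro eq_matI) (auto simp: scalar_prod_def)

text \<open>The adjoint of an \<open>hcat\<close> serves as vertical stacking, so this is block row
  times block column.\<close>

lemma hcat_mult_adjoint_hcat:
  assumes "dim_row A = dim_row B" "dim_row C = dim_row D" "dim_col A = dim_col C" "dim_col B = dim_col D"
  shows "hcat A B * (hcat C D)\<^sup>H = A * C\<^sup>H + B * D\<^sup>H"
proof -
  have "(hcat C D)\<^sup>H = four_block_mat (C\<^sup>H) (0\<^sub>m (dim_col C) 0) (D\<^sup>H) (0\<^sub>m (dim_col D) 0)"
    using assms by (intro eq_matI) auto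
  then have "hcat A B * (hcat C D)\<^sup>H = four_block_mat (A * C\<^sup>H + B * D\<^sup>H)
      (A * 0\<^sub>m (dim_col C) 0 + B * 0\<^sub>m (dim_col D) 0)
      (0\<^sub>m 0 (dim_col A) * C\<^sup>H + 0\<^sub>m 0 (dim_col B) * D\<^sup>H)
      (0\<^sub>m 0 (dim_col A) * 0\<^sub>m (dim_col C) 0 + 0\<^sub>m 0 (dim_col B) * 0\<^sub>m (dim_col D) 0)"
    unfolding hcat_def[of A B]
    by (simp only:, subst mult_four_block_mat[of _ "dim_row A" "dim_col A" _ "dim_col B" _ 0]) (use assms in auto)
  also have "\<dots> = A * C\<^sup>H + B * D\<^sup>H"
    using assms by (intro eq_matI) auto
  finally show ?thesis .
qed

lemma gram_hcat:
  assumes "dim_row A = dim_row C" "dim_row B = dim_row C" "dim_row D = dim_row C"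
  shows "(hcat A B)\<^sup>H * hcat C D = four_block_mat (A\<^sup>H * C) (A\<^sup>H * D) (B\<^sup>H * C) (B\<^sup>H * D)"
  using assms by (intro eq_matI) (auto simp: scalar_prod_def)

section \<open>Dimension counts from one-sided inverses\<close>

text \<open>If \<open>r\<close> exceeded \<open>m\<close>, zero padding would make both factors
  square and hence inverse in either order, but the reversed product has a zero at
  \<open>(m, m)\<close>, the first padded index.\<close>

lemma right_inverse_size:
  fixes X :: "complex mat"
  assumes "X \<in> carrier_mat r m" "Y \<in> carrier_mat m r" "X * Y = 1\<^sub>m r"
  shows "r \<le> m"
proof (rule ccontr)
  assume "\<not> r \<le> m"
  define k where "k = r - Suc m"
  have r: "r = m + Suc k" using \<open>\<not> r \<le> m\<close> by (auto simp: k_def)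
  have d [simp]: "dim_row X = r" "dim_col X = m" "dim_row Y = m" "dim_col Y = r"
    using assms by auto
  define X' where "X' = hcat X (0\<^sub>m r (Suc k))"
  define Y' where "Y' = (hcat (Y\<^sup>H) (0\<^sub>m r (Suc k)))\<^sup>H"
  have c: "X' \<in> carrier_mat r r" "Y' \<in> carrier_mat r r"
    by (auto simp: X'_def Y'_def r)
  have "X' * Y' = 1\<^sub>m r"
    unfolding X'_def Y'_def by (subst hcat_mult_adjoint_hcat) (auto simp: assms(3) mat_alg)
  then have "Y' * X' = 1\<^sub>m r" using mat_mult_left_right_inverse c by blast
  moreover have "(Y' * X') $$ (m, m) = 0"
    using c by (auto simp: X'_def r scalar_prod_def)
  ultimately show False by (simp add: r)
qed

lemma left_right_inverse:
  fixes X :: "complex mat"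
  assumes "X * Y = 1\<^sub>m r" "dim_col X = r" "dim_row Y = r"
  shows "Y * X = 1\<^sub>m r"
proof -
  have "dim_row (X * Y) = r" "dim_col (X * Y) = r" unfolding assms by auto
  then have "X \<in> carrier_mat r r" "Y \<in> carrier_mat r r" using assms(2,3) by auto
  then show ?thesis using mat_mult_left_right_inverse assms by blast
qed

subsection \<open>Generalized inverses and rank\<close>

text \<open>Take \<open>r\<close> maximal with \<open>L * A * D = 1\<close>: a nonzero entry of \<open>A - A * D * L * A\<close> would allow
  one more row of \<open>L\<close> and one more column of \<open>D\<close>.\<close>

lemma generalized_inverse:
  fixes A :: "complex mat"
  shows "\<exists>r L D. L \<in> carrier_mat r (dim_row A) \<and> D \<in> carrier_mat (dim_col A) r \<and>
    L * (A * D) = 1\<^sub>m r \<and> A * (D * (L * A)) = A"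
proof -
  define m n where mn: "m = dim_row A" "n = dim_col A"
  note mn [symmetric, simp]
  define P where "P r \<longleftrightarrow> (\<exists>L D. L \<in> carrier_mat r m \<and> D \<in> carrier_mat n r \<and> L * (A * D) = 1\<^sub>m r)" for r
  have "P 0" unfolding P_def
    by (intro exI[of _ "0\<^sub>m 0 m"] exI[of _ "0\<^sub>m n 0"]) (auto intro!: eq_matI)
  moreover have bound: "r \<le> m" if "P r" for r
  proof -
    from that obtain L D where "L \<in> carrier_mat r m" "D \<in> carrier_mat n r" "L * (A * D) = 1\<^sub>m r"
      by (auto simp: P_def)
    then show ?thesis by (intro right_inverse_size[of L r m "A * D"]) auto
  qed
  ultimately obtain r where r: "P r" "\<And>s. P s \<Longrightarrow> s \<le> r"
    using GreatestI_nat[of P 0 m] Greatest_le_nat[of P _ m] by blast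
  then obtain L D where LD: "L \<in> carrier_mat r m" "D \<in> carrier_mat n r" "L * (A * D) = 1\<^sub>m r"
    by (auto simp: P_def)
  from LD(1,2) have [simp]: "dim_row L = r" "dim_col L = m" "dim_row D = n" "dim_col D = r" by auto
  note LD3 = mult3_eq_left[OF LD(3)]
  define E where "E = A - A * (D * (L * A))"
  have [simp]: "dim_row E = m" "dim_col E = n" by (auto simp: E_def)
  have "E $$ (i, j) = 0" if ij: "i < m" "j < n" for i j
  proof (rule ccontr)
    assume nz: "E $$ (i, j) \<noteq> 0"
    \<comment> \<open>\<open>u\<close> and \<open>w\<close> select the entry \<open>(i, j)\<close>;
      the scaling of \<open>w\<close> makes \<open>u * (E * w)\<close> the identity.\<close>
    define u :: "complex mat" where "u = mat 1 m (\<lambda>(_, k). if k = i then 1 else 0)"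
    define w :: "complex mat" where "w = mat n 1 (\<lambda>(k, _). if k = j then 1 / E $$ (i, j) else 0)"
    have [simp]: "dim_row u = 1" "dim_col u = m" "dim_row w = n" "dim_col w = 1"
      by (auto simp: u_def w_def)
    have uEw: "u * (E * w) = 1\<^sub>m 1"
    proof -
      have [simp]: "(if b then 1 else 0) * t = (if b then t else 0)"
        "t * (if b then s else 0) = (if b then t * s else 0)" for b and s t :: complex by auto
      show ?thesis
        using nz ij by (intro eq_matI) (auto simp: u_def w_def scalar_prod_def simp flip: sum_divide_distrib)
    qed
    \<comment> \<open>These corrections decouple the new row and column from \<open>L\<close> and
      \<open>D\<close> while keeping \<open>y * (A * x)\<close> equal to
      \<open>u * (E * w)\<close>.\<close>
    define y x where "y = u - u * (A * (D * L))" and "x = w - D * (L * (A * w))"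
    have [simp]: "dim_row y = 1" "dim_col y = m" "dim_row x = n" "dim_col x = 1"
      by (auto simp: x_def y_def)
    have "L * (A * x) = 0\<^sub>m r 1" "y * (A * D) = 0\<^sub>m 1 r" "y * (A * x) = u * (E * w)"
      by (simp_all add: x_def y_def E_def mat_alg LD LD3)
    moreover have "A * hcat D x = hcat (A * D) (A * x)" by (simp add: mult_hcat)
    ultimately have "(hcat (L\<^sup>H) (y\<^sup>H))\<^sup>H * (A * hcat D x) = 1\<^sub>m (r + 1)"
      using LD by (simp add: gram_hcat uEw)
    then have "P (r + 1)"
      unfolding P_def by (intro exI[of _ "(hcat (L\<^sup>H) (y\<^sup>H))\<^sup>H"] exI[of _ "hcat D x"]) auto
    then show False using r(2) by fastforce
  qed
  then have eq: "A $$ (i, j) = (A * (D * (L * A))) $$ (i, j)" if "i < m" "j < n" for i j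
    using that by (simp add: E_def del: index_mult_mat(1))
  have "A * (D * (L * A)) = A"
    by (rule eq_matI, rule eq[symmetric]) simp_all
  with LD show ?thesis unfolding mn by blast
qed

text \<open>\<open>A\<close> factors through \<open>A * D\<close>, so both have the same column
  space, and the left inverse \<open>L\<close> makes the \<open>r\<close> columns of
  \<open>A * D\<close> distinct and independent.\<close>

lemma rank_eqI:
  fixes A :: "complex mat"
  assumes "A \<in> carrier_mat m n" "L \<in> carrier_mat r m" "D \<in> carrier_mat n r"
    and "L * (A * D) = 1\<^sub>m r" "A * (D * (L * A)) = A"
  shows "vec_space.rank m A = r"
proof -
  interpret vec_space "TYPE(complex)" m .
  define B where "B = A * D"
  have B: "B \<in> carrier_mat m r" "L * B = 1\<^sub>m r" using assms by (auto simp: B_def)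
  have BD: "B *\<^sub>v w = A *\<^sub>v (D *\<^sub>v w)" if "w \<in> carrier_vec r" for w
    unfolding B_def using assms(1,3) that by (rule assoc_mult_mat_vec)
  have LB: "L *\<^sub>v (B *\<^sub>v w) = w" if "w \<in> carrier_vec r" for w
    using assoc_mult_mat_vec[OF assms(2) B(1) that] B(2) that by simp
  have AB: "A *\<^sub>v v = B *\<^sub>v ((L * A) *\<^sub>v v)" if "v \<in> carrier_vec n" for v
  proof -
    have "B * (L * A) = A" unfolding B_def using assms(5)
      by (subst assoc_mult_mat[OF assms(1,3) mult_carrier_mat[OF assms(2,1)]])
    then show ?thesis
      using assoc_mult_mat_vec[OF B(1) mult_carrier_mat[OF assms(2,1)] that] by simp
  qed
  have "col_space A = col_space B"
  proof -
    have "(\<exists>v\<in>carrier_vec n. A *\<^sub>v v = y) \<longleftrightarrow> (\<exists>w\<in>carrier_vec r. B *\<^sub>v w = y)" for y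
      using AB BD assms(1-3) by (metis mult_carrier_mat mult_mat_vec_carrier)
    then show ?thesis
      unfolding col_space_eq[OF assms(1)] col_space_eq[OF B(1)] using assms(1) B(1) by simp
  qed
  then have "rank A = rank B" unfolding rank_def col_space_def by simp
  also have "rank B = r"
  proof (rule lin_indpt_full_rank[OF B(1)])
    show "distinct (cols B)"
    proof (subst distinct_conv_nth, intro allI impI)
      fix i j assume "i < length (cols B)" "j < length (cols B)" "i \<noteq> j"
      then have ij: "i < r" "j < r" using B(1) by auto
      have "L *\<^sub>v (cols B ! k) = unit_vec r k" if "k < r" for k
        using col_mult2[OF assms(2) B(1) that] B that by simp
      then show "cols B ! i \<noteq> cols B ! j"
        using ij \<open>i \<noteq> j\<close> by (metis index_unit_vec(1) zero_neq_one)
    qed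
    then show "lin_indpt (set (cols B))"
    proof (rule_tac ccontr)
      assume "distinct (cols B)" "\<not> lin_indpt (set (cols B))"
      then obtain v where v: "v \<in> carrier_vec r" "v \<noteq> 0\<^sub>v r" "B *\<^sub>v v = 0\<^sub>v m"
        using lin_depE[OF B(1)] by blast
      have "L *\<^sub>v 0\<^sub>v m = 0\<^sub>v r" using assms(2) by (intro eq_vecI) auto
      then show False using LB[OF v(1)] v by simp
    qed
  qed
  finally show ?thesis .
qed

text \<open>With \<open>E = 1 - B * L\<close> idempotent, a generalized inverse \<open>D * L'\<close> of \<open>E\<close> yields the
  complementary pair \<open>H = E * D\<close>, \<open>Y = L' * E\<close>.\<close>
lemma left_inverse_completion:
  fixes B :: "complex mat"
  assumes "B \<in> carrier_mat m r" "L \<in> carrier_mat r m" and LB: "L * B = 1\<^sub>m r"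
  obtains H Y where "r \<le> m" "H \<in> carrier_mat m (m - r)" "Y \<in> carrier_mat (m - r) m"
    "Y * H = 1\<^sub>m (m - r)" "Y * B = 0\<^sub>m (m - r) r" "L * H = 0\<^sub>m r (m - r)" "B * L + H * Y = 1\<^sub>m m"
proof -
  have [simp]: "dim_row B = m" "dim_col B = r" "dim_row L = r" "dim_col L = m" using assms by auto
  note LB2 = mult2_eq_left[OF LB]
  define E where "E = 1\<^sub>m m - B * L"
  have [simp]: "dim_row E = m" "dim_col E = m" by (auto simp: E_def)
  have E: "E * E = E" "L * E = 0\<^sub>m r m" "E * B = 0\<^sub>m m r"
    by (simp_all add: E_def mat_alg LB LB2)
  note E2 = mult2_eq_left[OF E(1)] mult2_eq_left[OF E(2)]
  obtain s L' D where L'D: "L' \<in> carrier_mat s m" "D \<in> carrier_mat m s"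
      "L' * (E * D) = 1\<^sub>m s" "E * (D * (L' * E)) = E"
    using generalized_inverse[of E] by auto
  have [simp]: "dim_row L' = s" "dim_col L' = m" "dim_row D = m" "dim_col D = s" using L'D by auto
  define H Y where "H = E * D" and "Y = L' * E"
  have [simp]: "dim_row H = m" "dim_col H = s" "dim_row Y = s" "dim_col Y = m"
    by (auto simp: H_def Y_def)
  have 1: "Y * H = 1\<^sub>m s" "Y * B = 0\<^sub>m s r" "L * H = 0\<^sub>m r s"
    by (simp_all add: H_def Y_def mat_alg E E2 L'D)
  have "H * Y = E"
    by (simp add: H_def Y_def mat_alg L'D)
  then have 2: "B * L + H * Y = 1\<^sub>m m"
    by (simp add: E_def mat_alg)
  \<comment> \<open>The stacked factors are inverse in both orders; one order bounds
    \<open>m\<close> by \<open>r + s\<close>, the other \<open>r + s\<close> by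
    \<open>m\<close>.\<close>
  have "hcat B H * (hcat (L\<^sup>H) (Y\<^sup>H))\<^sup>H = 1\<^sub>m m"
    by (subst hcat_mult_adjoint_hcat) (simp_all add: 2)
  then have "m \<le> r + s"
    by (intro right_inverse_size[of "hcat B H" m "r + s" "(hcat (L\<^sup>H) (Y\<^sup>H))\<^sup>H"]) auto
  moreover have "(hcat (L\<^sup>H) (Y\<^sup>H))\<^sup>H * hcat B H = 1\<^sub>m (r + s)"
    by (simp add: gram_hcat LB 1)
  then have "r + s \<le> m"
    by (intro right_inverse_size[of "(hcat (L\<^sup>H) (Y\<^sup>H))\<^sup>H" "r + s" m "hcat B H"]) auto
  ultimately have "s = m - r" "r \<le> m" by auto
  moreover have "H \<in> carrier_mat m s" "Y \<in> carrier_mat s m" by auto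
  ultimately show ?thesis using that[of H Y] 1 2 by simp
qed

text \<open>The columns of \<open>K\<close> span the kernel and the rows of \<open>Y\<close> the
  left kernel, with one-sided inverses \<open>G\<close> and \<open>H\<close>. The last two
  identities split domain and codomain; they arise by completing \<open>D\<close> with
  \<open>L * A\<close> and \<open>A * D\<close> with \<open>L\<close>.\<close>

lemma kernel_range_split:
  fixes A :: "complex mat"
  assumes "A \<in> carrier_mat m n"
  obtains r L D K G H Y where "r \<le> m" "r \<le> n" "vec_space.rank m A = r"
    "L \<in> carrier_mat r m" "D \<in> carrier_mat n r" "K \<in> carrier_mat n (n - r)"
    "G \<in> carrier_mat (n - r) n" "H \<in> carrier_mat m (m - r)" "Y \<in> carrier_mat (m - r) m"
    "L * (A * D) = 1\<^sub>m r" "A * K = 0\<^sub>m m (n - r)" "G * K = 1\<^sub>m (n - r)" "Y * A = 0\<^sub>m (m - r) n"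
    "Y * H = 1\<^sub>m (m - r)" "D * (L * A) + K * G = 1\<^sub>m n" "A * (D * L) + H * Y = 1\<^sub>m m"
proof -
  have [simp]: "dim_row A = m" "dim_col A = n" using assms by auto
  obtain r L D where LD: "L \<in> carrier_mat r m" "D \<in> carrier_mat n r"
      "L * (A * D) = 1\<^sub>m r" "A * (D * (L * A)) = A"
    using generalized_inverse[of A] by auto
  have [simp]: "dim_row L = r" "dim_col L = m" "dim_row D = n" "dim_col D = r" using LD by auto
  note rank = rank_eqI[OF assms LD]
  have c: "A * D \<in> carrier_mat m r" "L * A \<in> carrier_mat r n" "(L * A) * D = 1\<^sub>m r"
    by (auto simp: mult_assoc_dim LD(3))
  obtain H Y where HY: "r \<le> m" "H \<in> carrier_mat m (m - r)" "Y \<in> carrier_mat (m - r) m"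
      "Y * H = 1\<^sub>m (m - r)" "Y * (A * D) = 0\<^sub>m (m - r) r" "L * H = 0\<^sub>m r (m - r)"
      "(A * D) * L + H * Y = 1\<^sub>m m"
    by (rule left_inverse_completion[OF c(1) LD(1,3)])
  obtain K G where KG: "r \<le> n" "K \<in> carrier_mat n (n - r)" "G \<in> carrier_mat (n - r) n"
      "G * K = 1\<^sub>m (n - r)" "G * D = 0\<^sub>m (n - r) r" "(L * A) * K = 0\<^sub>m r (n - r)"
      "D * (L * A) + K * G = 1\<^sub>m n"
    by (rule left_inverse_completion[OF LD(2) c(2,3)])
  have [simp]: "dim_row K = n" "dim_col K = n - r" "dim_row Y = m - r" "dim_col Y = m" using HY KG by auto
  have "Y * A = Y * ((A * D) * (L * A))" by (simp add: mat_alg LD)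
  also have "\<dots> = 0\<^sub>m (m - r) n" by (subst mult2_eq_left[OF HY(5)]) (simp_all add: mat_alg)
  finally have YA: "Y * A = 0\<^sub>m (m - r) n" .
  have "A * K = (A * (D * (L * A))) * K" by (simp only: LD)
  also have "\<dots> = (A * D) * ((L * A) * K)" by (simp add: mat_alg)
  also have "\<dots> = 0\<^sub>m m (n - r)" unfolding KG by (simp add: mat_alg)
  finally have "A * K = 0\<^sub>m m (n - r)" .
  moreover have "A * (D * L) + H * Y = 1\<^sub>m m"
    using HY(7) by (simp add: mult_assoc_dim)
  ultimately show ?thesis using that[of r L D K G H Y] rank LD HY KG YA by blast
qed

text \<open>Injectivity applied to the kernel basis \<open>K\<close> itself makes it vanish, and the
  splitting of the identity leaves \<open>D * L\<close> as left inverse.\<close>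

lemma left_inverse_exists:
  fixes A :: "complex mat"
  assumes "A \<in> carrier_mat m n"
    and inj: "\<And>k X. X \<in> carrier_mat n k \<Longrightarrow> A * X = 0\<^sub>m m k \<Longrightarrow> X = 0\<^sub>m n k"
  obtains F where "F \<in> carrier_mat n m" "F * A = 1\<^sub>m n"
proof -
  from assms(1) obtain r L D K G where
    "L \<in> carrier_mat r m" "D \<in> carrier_mat n r" "K \<in> carrier_mat n (n - r)" "G \<in> carrier_mat (n - r) n"
    "A * K = 0\<^sub>m m (n - r)" "D * (L * A) + K * G = 1\<^sub>m n"
    by (rule kernel_range_split)
  note s = this
  have [simp]: "dim_row A = m" "dim_col A = n" "dim_row L = r" "dim_col L = m" "dim_row D = n"
    "dim_col D = r" "dim_row G = n - r" "dim_col G = n"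
    using s assms by auto
  have "K = 0\<^sub>m n (n - r)" using s inj by blast
  then have "D * L * A = 1\<^sub>m n"
    using s(6) by (simp add: mat_alg)
  moreover have "D * L \<in> carrier_mat n m" using s by auto
  ultimately show ?thesis by (rule that[rotated])
qed

subsection \<open>Symplectic bases\<close>

lemma gram_form_hcat:
  assumes "dim_row A = dim_row Z" "dim_row B = dim_row Z" "dim_row C = dim_col Z" "dim_row D = dim_col Z"
  shows "(hcat A B)\<^sup>H * (Z * hcat C D) =
    four_block_mat (A\<^sup>H * (Z * C)) (A\<^sup>H * (Z * D)) (B\<^sup>H * (Z * C)) (B\<^sup>H * (Z * D))"
proof -
  have "Z * hcat C D = hcat (Z * C) (Z * D)" using assms by (simp add: mult_hcat)
  then show ?thesis using assms by (simp add: gram_hcat)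
qed

section \<open>The standard form and isotropic families\<close>

lemma Jmat_dim [simp]: "dim_row (Jmat n) = 2 * n" "dim_col (Jmat n) = 2 * n"
  by (auto simp: Jmat_def)

lemma Jmat_carrier [simp]: "Jmat n \<in> carrier_mat (2*n) (2*n)"
  by (rule carrier_matI) simp_all

text \<open>\<open>P\<close> and \<open>R\<close> embed the two halves of the coordinates, so block
  computations with the form become rewriting with orthonormality relations.\<close>

lemma Jmat_lagrangian_frame:
  obtains P R where "P \<in> carrier_mat (2*n) n" "R \<in> carrier_mat (2*n) n"
    "P\<^sup>H * P = 1\<^sub>m n" "R\<^sup>H * R = 1\<^sub>m n" "P\<^sup>H * R = 0\<^sub>m n n" "R\<^sup>H * P = 0\<^sub>m n n"
    "P * P\<^sup>H + R * R\<^sup>H = 1\<^sub>m (2*n)" "Jmat n = P * R\<^sup>H - R * P\<^sup>H"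
proof -
  define P where "P = (hcat (1\<^sub>m n) (0\<^sub>m n n))\<^sup>H"
  define R where "R = (hcat (0\<^sub>m n n) (1\<^sub>m n))\<^sup>H"
  have d: "P \<in> carrier_mat (2*n) n" "R \<in> carrier_mat (2*n) n"
    by (rule carrier_matI; simp add: P_def R_def)+
  have 1: "P\<^sup>H * P = 1\<^sub>m n" "R\<^sup>H * R = 1\<^sub>m n" "P\<^sup>H * R = 0\<^sub>m n n" "R\<^sup>H * P = 0\<^sub>m n n"
    by (simp_all add: P_def R_def hcat_mult_adjoint_hcat mat_alg)
  have 2: "P * P\<^sup>H = four_block_mat (1\<^sub>m n) (0\<^sub>m n n) (0\<^sub>m n n) (0\<^sub>m n n)"
    "R * R\<^sup>H = four_block_mat (0\<^sub>m n n) (0\<^sub>m n n) (0\<^sub>m n n) (1\<^sub>m n)"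
    "P * R\<^sup>H = four_block_mat (0\<^sub>m n n) (1\<^sub>m n) (0\<^sub>m n n) (0\<^sub>m n n)"
    "R * P\<^sup>H = four_block_mat (0\<^sub>m n n) (0\<^sub>m n n) (1\<^sub>m n) (0\<^sub>m n n)"
    by (simp_all add: P_def R_def gram_hcat mat_alg del: four_block_zero_mat)
  have 3: "P * P\<^sup>H + R * R\<^sup>H = 1\<^sub>m (2*n)" unfolding 2 by (intro eq_matI) auto
  have 4: "Jmat n = P * R\<^sup>H - R * P\<^sup>H" unfolding 2 Jmat_def by (intro eq_matI) auto
  show ?thesis by (rule that[OF d 1 3 4])
qed

lemma Jmat_adjoint [simp]: "(Jmat n)\<^sup>H = - Jmat n"
proof -
  obtain P R where "P \<in> carrier_mat (2*n) n" "R \<in> carrier_mat (2*n) n" "Jmat n = P * R\<^sup>H - R * P\<^sup>H"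
    by (rule Jmat_lagrangian_frame)
  then show ?thesis by (auto simp: mat_alg adj_alg)
qed

lemma Jmat_square: "Jmat n * Jmat n = - 1\<^sub>m (2*n)"
proof -
  obtain P R where PR: "P \<in> carrier_mat (2*n) n" "R \<in> carrier_mat (2*n) n"
    "P\<^sup>H * P = 1\<^sub>m n" "R\<^sup>H * R = 1\<^sub>m n" "P\<^sup>H * R = 0\<^sub>m n n" "R\<^sup>H * P = 0\<^sub>m n n"
    "P * P\<^sup>H + R * R\<^sup>H = 1\<^sub>m (2*n)" "Jmat n = P * R\<^sup>H - R * P\<^sup>H"
    by (rule Jmat_lagrangian_frame)
  from PR(1,2) have [simp]: "dim_row P = 2*n" "dim_col P = n" "dim_row R = 2*n" "dim_col R = n" by auto
  note [simp] = PR(3-6) PR(3-6)[THEN mult2_eq_left]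
  have "Jmat n * Jmat n = - (P * P\<^sup>H + R * R\<^sup>H)"
    unfolding PR(8) by (simp add: mat_alg)
  then show ?thesis unfolding PR(7) .
qed

text \<open>In a Lagrangian splitting \<open>E = [E1; E2]\<close>, isotropy says \<open>E1\<^sup>H E2 = E2\<^sup>H E1\<close>, so \<open>E1\<close> maps
  \<open>ker E2\<close> into \<open>ker E2\<^sup>H\<close>. Any complement of the image there, padded with zeros, extends \<open>E\<close>.\<close>
lemma isotropic_extension:
  assumes "E \<in> carrier_mat (2*n) l" "F \<in> carrier_mat l (2*n)" and FE: "F * E = 1\<^sub>m l"
    and iso: "E\<^sup>H * (Jmat n * E) = 0\<^sub>m l l"
  obtains A Z where "l \<le> n" "A \<in> carrier_mat (2*n) (n - l)" "Z \<in> carrier_mat (n - l) (2*n)"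
    "E\<^sup>H * (Jmat n * A) = 0\<^sub>m l (n - l)" "A\<^sup>H * (Jmat n * A) = 0\<^sub>m (n - l) (n - l)"
    "Z * A = 1\<^sub>m (n - l)" "Z * E = 0\<^sub>m (n - l) l"
proof -
  obtain P R where PR: "P \<in> carrier_mat (2*n) n" "R \<in> carrier_mat (2*n) n"
    "P\<^sup>H * P = 1\<^sub>m n" "R\<^sup>H * R = 1\<^sub>m n" "P\<^sup>H * R = 0\<^sub>m n n" "R\<^sup>H * P = 0\<^sub>m n n"
    "P * P\<^sup>H + R * R\<^sup>H = 1\<^sub>m (2*n)" "Jmat n = P * R\<^sup>H - R * P\<^sup>H"
    by (rule Jmat_lagrangian_frame)
  from PR(1,2) have [simp]: "dim_row P = 2*n" "dim_col P = n" "dim_row R = 2*n" "dim_col R = n" by auto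
  from assms have [simp]: "dim_row E = 2*n" "dim_col E = l" "dim_row F = l" "dim_col F = 2*n" by auto
  note PRs = PR(3-6) PR(3-6)[THEN mult2_eq_left]
  define E1 E2 where "E1 = P\<^sup>H * E" and "E2 = R\<^sup>H * E"
  have [simp]: "dim_row E1 = n" "dim_col E1 = l" "dim_row E2 = n" "dim_col E2 = l"
    by (auto simp: E1_def E2_def)
  have PRE: "P\<^sup>H * E = E1" "R\<^sup>H * E = E2" "E\<^sup>H * P = E1\<^sup>H" "E\<^sup>H * R = E2\<^sup>H"
    by (simp_all add: E1_def E2_def adj_alg)
  note PREs = PRE PRE[THEN mult2_eq_left]
  have "E1\<^sup>H * E2 - E2\<^sup>H * E1 = 0\<^sub>m l l"
    using iso unfolding PR(8) by (simp add: mat_alg PREs)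
  then have sym: "E2\<^sup>H * E1 = E1\<^sup>H * E2"
    by (intro eq_matI) (auto simp: mat_eq_iff simp del: index_mult_mat(1))
  have "E2 \<in> carrier_mat n l" by (rule carrier_matI) simp_all
  then obtain t L D K G H Y where t: "t \<le> n" "t \<le> l" "vec_space.rank n E2 = t"
    and c: "L \<in> carrier_mat t n" "D \<in> carrier_mat l t" "K \<in> carrier_mat l (l - t)"
      "G \<in> carrier_mat (l - t) l" "H \<in> carrier_mat n (n - t)" "Y \<in> carrier_mat (n - t) n"
    and s: "L * (E2 * D) = 1\<^sub>m t" "E2 * K = 0\<^sub>m n (l - t)" "G * K = 1\<^sub>m (l - t)"
      "Y * E2 = 0\<^sub>m (n - t) l" "Y * H = 1\<^sub>m (n - t)" "D * (L * E2) + K * G = 1\<^sub>m l"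
      "E2 * (D * L) + H * Y = 1\<^sub>m n"
    by (rule kernel_range_split)
  from c have [simp]: "dim_row L = t" "dim_col L = n" "dim_row D = l" "dim_col D = t" "dim_row K = l"
    "dim_col K = l - t" "dim_row G = l - t" "dim_col G = l" "dim_row H = n" "dim_col H = n - t"
    "dim_row Y = n - t" "dim_col Y = n" by auto
  \<comment> \<open>\<open>E1 * K\<close> lies in the kernel of \<open>E2\<^sup>H\<close>, which is
    the range of \<open>Y\<^sup>H\<close>; \<open>C\<close> holds its coordinates there.\<close>
  define C where "C = H\<^sup>H * (E1 * K)"
  have [simp]: "dim_row C = n - t" "dim_col C = l - t" by (auto simp: C_def)
  have symK: "E2\<^sup>H * (E1 * K) = 0\<^sub>m l (l - t)"
    by (subst mult2_eq_left[OF sym]) (simp_all add: mat_alg s(2))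
  have YC: "Y\<^sup>H * C = E1 * K"
  proof -
    have "E1 * K = (E2 * (D * L) + H * Y)\<^sup>H * (E1 * K)"
      unfolding s(7) by (simp add: mat_alg)
    also have "\<dots> = Y\<^sup>H * C"
      by (simp add: adj_alg mat_alg symK C_def)
    finally show ?thesis ..
  qed
  \<comment> \<open>A left inverse of \<open>C\<close>: as \<open>E2 * K = 0\<close>,
    \<open>E * K\<close> lives in the \<open>P\<close> half alone, so \<open>F\<close> recovers
    \<open>K\<close> from \<open>P * (E1 * K)\<close> and \<open>G\<close> cancels
    \<open>K\<close>.\<close>
  define X where "X = G * (F * (P * Y\<^sup>H))"
  have FPE: "F * (P * (E1 * K)) = K"
  proof -
    have "K = F * ((P * P\<^sup>H + R * R\<^sup>H) * (E * K))"
      unfolding PR(7) by (simp add: mat_alg mult2_eq_left[OF FE])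
    also have "\<dots> = F * (P * (E1 * K))"
      by (simp add: mat_alg PREs s(2))
    finally show ?thesis ..
  qed
  have XC: "X * C = 1\<^sub>m (l - t)"
    by (simp add: X_def mat_alg YC FPE s(3))
  have cC: "C \<in> carrier_mat (n - t) (l - t)" "X \<in> carrier_mat (l - t) (n - t)"
    by (rule carrier_matI; simp add: X_def)+
  \<comment> \<open>\<open>Hc\<close> complements the range of \<open>C\<close>; its width
    \<open>(n - t) - (l - t)\<close> equals \<open>n - l\<close>.\<close>
  obtain Hc Yc where le: "l - t \<le> n - t"
    and "Hc \<in> carrier_mat (n - t) (n - t - (l - t))" "Yc \<in> carrier_mat (n - t - (l - t)) (n - t)"
      "Yc * Hc = 1\<^sub>m (n - t - (l - t))" "Yc * C = 0\<^sub>m (n - t - (l - t)) (l - t)"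
      "X * Hc = 0\<^sub>m (l - t) (n - t - (l - t))" "C * X + Hc * Yc = 1\<^sub>m (n - t)"
    by (rule left_inverse_completion[OF cC XC])
  note h = this
  have "l \<le> n" "n - t - (l - t) = n - l" using le t by auto
  note h = h[unfolded \<open>n - t - (l - t) = n - l\<close>]
  from h have [simp]: "dim_row Hc = n - t" "dim_col Hc = n - l" "dim_row Yc = n - l" "dim_col Yc = n - t"
    by auto
  \<comment> \<open>Lying in the \<open>P\<close> half makes \<open>A\<close> isotropic; components
    in the kernel of \<open>E2\<^sup>H\<close> make it orthogonal to \<open>E\<close>.\<close>
  define A where "A = P * (Y\<^sup>H * Hc)"
  define Z1 where "Z1 = Yc * H\<^sup>H"
  \<comment> \<open>The second term leaves only the \<open>K\<close> part of \<open>E1\<close> when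
    \<open>Z\<close> meets \<open>E\<close>, and \<open>Yc\<close> annihilates that through
    \<open>C\<close>. On \<open>A\<close> it vanishes because
    \<open>R\<^sup>H * P = 0\<close>.\<close>
  define Z where "Z = Z1 * P\<^sup>H - Z1 * (E1 * (D * (L * R\<^sup>H)))"
  have [simp]: "dim_row A = 2*n" "dim_col A = n - l" "dim_row Z1 = n - l" "dim_col Z1 = n"
    "dim_row Z = n - l" "dim_col Z = 2*n" by (simp_all add: A_def Z1_def Z_def)
  have YH: "H\<^sup>H * Y\<^sup>H = 1\<^sub>m (n - t)" "E2\<^sup>H * Y\<^sup>H = 0\<^sub>m l (n - t)"
    using arg_cong[OF s(5), of mat_adjoint] arg_cong[OF s(4), of mat_adjoint]
    by (simp_all add: adj_alg)
  note YHs = YH YH[THEN mult2_eq_left]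
  have "A \<in> carrier_mat (2*n) (n - l)" "Z \<in> carrier_mat (n - l) (2*n)"
    by (rule carrier_matI; simp)+
  moreover have "E\<^sup>H * (Jmat n * A) = 0\<^sub>m l (n - l)"
    unfolding PR(8) by (simp add: A_def mat_alg PRs PREs YHs)
  moreover have "A\<^sup>H * (Jmat n * A) = 0\<^sub>m (n - l) (n - l)"
    unfolding PR(8) by (simp add: A_def mat_alg adj_alg PRs)
  moreover have "Z * A = 1\<^sub>m (n - l)"
    by (simp add: Z_def A_def Z1_def mat_alg PRs YHs h)
  moreover have "Z * E = 0\<^sub>m (n - l) l"
  proof -
    have "Z * E = Z1 * (E1 * (1\<^sub>m l - D * (L * E2)))"
      by (simp add: Z_def mat_alg PREs)
    also have "1\<^sub>m l - D * (L * E2) = K * G"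
      unfolding s(6)[symmetric] by (simp add: mat_alg)
    also have "Z1 * (E1 * (K * G)) = Yc * (C * G)"
      by (simp add: Z1_def C_def mat_alg)
    also have "\<dots> = 0\<^sub>m (n - l) l"
      by (subst mult2_eq_left[OF h(5)]) (simp_all add: mat_alg)
    finally show ?thesis .
  qed
  ultimately show ?thesis by (rule that[OF \<open>l \<le> n\<close>])
qed

text \<open>The form is skew-Hermitian, so a pairing in one order determines the other.\<close>

lemma Jmat_form_swap:
  assumes "dim_row X = 2*n" "dim_row Y = 2*n"
  shows "X\<^sup>H * (Jmat n * Y) = - (Y\<^sup>H * (Jmat n * X))\<^sup>H"
  using assms by (simp add: adj_alg mat_alg)

lemma hcat_zero [simp]: "hcat (0\<^sub>m r m) (0\<^sub>m r n) = 0\<^sub>m r (m + n)"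
  by (intro eq_matI) auto

text \<open>An isotropic extension of \<open>E\<close> is corrected along \<open>E\<close> to an isotropic \<open>A\<close> orthogonal to \<open>W\<close>; its
  left inverse \<open>Z\<close> gives a dual family \<open>B'\<close>, and adding \<open>A * K / 2\<close> removes the Gram matrix \<open>K\<close> of
  \<open>B'\<close>.\<close>

lemma symplectic_complement:
  assumes "E \<in> carrier_mat (2*n) l" "W \<in> carrier_mat (2*n) l"
    and EE: "E\<^sup>H * (Jmat n * E) = 0\<^sub>m l l" and WW: "W\<^sup>H * (Jmat n * W) = 0\<^sub>m l l"
    and EW: "E\<^sup>H * (Jmat n * W) = 1\<^sub>m l"
  obtains V where "l \<le> n" "V \<in> carrier_mat (2*n) (2*(n-l))"
    "V\<^sup>H * (Jmat n * V) = Jmat (n - l)"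
    "E\<^sup>H * (Jmat n * V) = 0\<^sub>m l (2*(n-l))" "W\<^sup>H * (Jmat n * V) = 0\<^sub>m l (2*(n-l))"
proof -
  from assms have [simp]: "dim_row E = 2*n" "dim_col E = l" "dim_row W = 2*n" "dim_col W = l" by auto
  have WE: "W\<^sup>H * (Jmat n * E) = - 1\<^sub>m l"
    by (subst Jmat_form_swap) (simp_all add: EW)
  have F: "- W\<^sup>H * Jmat n \<in> carrier_mat l (2*n)" "- W\<^sup>H * Jmat n * E = 1\<^sub>m l"
    by (rule carrier_matI; simp) (simp add: mat_alg WE)
  obtain A' Z where "l \<le> n" "A' \<in> carrier_mat (2*n) (n - l)" "Z \<in> carrier_mat (n - l) (2*n)"
    and EA': "E\<^sup>H * (Jmat n * A') = 0\<^sub>m l (n - l)" and AA': "A'\<^sup>H * (Jmat n * A') = 0\<^sub>m (n - l) (n - l)"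
    and ZA': "Z * A' = 1\<^sub>m (n - l)" and ZE: "Z * E = 0\<^sub>m (n - l) l"
    by (rule isotropic_extension[OF assms(1) F EE])
  then have [simp]: "dim_row A' = 2*n" "dim_col A' = n-l" "dim_row Z = n-l" "dim_col Z = 2*n" by auto
  define m where "m = n - l"
  note m_def [symmetric, simp]
  note [simp] = EE WW EW WE EA' AA' ZA' ZE
  have JJ: "Jmat n * (Jmat n * X) = - X" if "dim_row X = 2*n" for X
    using that by (subst mult2_eq_left[OF Jmat_square]) (simp_all add: mat_alg)
  have A'E: "A'\<^sup>H * (Jmat n * E) = 0\<^sub>m m l"
    by (subst Jmat_form_swap) (simp_all add: mat_alg)
  note [simp] = EE[THEN mult3_eq_left] WW[THEN mult3_eq_left] EW[THEN mult3_eq_left]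
    WE[THEN mult3_eq_left] EA'[THEN mult3_eq_left] AA'[THEN mult3_eq_left] ZE[THEN mult2_eq_left]
    A'E A'E[THEN mult3_eq_left]
  define A where "A = A' + E * (W\<^sup>H * (Jmat n * A'))"
  \<comment> \<open>As the form squares to minus one, it turns the first term into
    \<open>Z\<^sup>H\<close>, whose pairing with \<open>A'\<close> is the identity; the second
    cancels the pairing with \<open>W\<close>.\<close>
  define B' where "B' = - (Jmat n * Z\<^sup>H) + E * (W\<^sup>H * Z\<^sup>H)"
  have [simp]: "dim_row A = 2*n" "dim_col A = m" "dim_row B' = 2*n" "dim_col B' = m"
    by (simp_all add: A_def B'_def)
  have ZAH: "A'\<^sup>H * Z\<^sup>H = 1\<^sub>m m" "E\<^sup>H * Z\<^sup>H = 0\<^sub>m l m"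
    by (simp_all flip: adjoint_mult_dim)
  have A: "E\<^sup>H * (Jmat n * A) = 0\<^sub>m l m" "W\<^sup>H * (Jmat n * A) = 0\<^sub>m l m"
      "A\<^sup>H * (Jmat n * A) = 0\<^sub>m m m"
    by (simp_all add: A_def mat_alg adj_alg)
  have B': "E\<^sup>H * (Jmat n * B') = 0\<^sub>m l m" "W\<^sup>H * (Jmat n * B') = 0\<^sub>m l m"
      "A\<^sup>H * (Jmat n * B') = 1\<^sub>m m"
    by (simp_all add: A_def B'_def mat_alg adj_alg JJ ZAH ZAH[THEN mult2_eq_left])
  have B'A: "B'\<^sup>H * (Jmat n * A) = - 1\<^sub>m m"
    by (subst Jmat_form_swap) (simp_all add: B')
  define K where "K = B'\<^sup>H * (Jmat n * B')"
  have [simp]: "dim_row K = m" "dim_col K = m" by (simp_all add: K_def)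
  have KH: "K\<^sup>H = - K" unfolding K_def by (subst (2) Jmat_form_swap) simp_all
  define X where "X = (1/2) \<cdot>\<^sub>m K"
  have [simp]: "dim_row X = m" "dim_col X = m" by (simp_all add: X_def)
  have XH: "X\<^sup>H = - X" by (intro eq_matI) (auto simp: X_def KH)
  define B where "B = B' + A * X"
  have [simp]: "dim_row B = 2*n" "dim_col B = m" by (simp_all add: B_def)
  note rules = A B' B'A A[THEN mult3_eq_left] B'A[THEN mult3_eq_left]
  have B: "E\<^sup>H * (Jmat n * B) = 0\<^sub>m l m" "W\<^sup>H * (Jmat n * B) = 0\<^sub>m l m"
      "A\<^sup>H * (Jmat n * B) = 1\<^sub>m m"
    by (simp_all add: B_def mat_alg rules)
  have BA: "B\<^sup>H * (Jmat n * A) = - 1\<^sub>m m"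
    by (subst Jmat_form_swap) (simp_all add: B)
  \<comment> \<open>The cross terms contribute \<open>- X\<close> and \<open>X\<^sup>H\<close>,
    which is again \<open>- X\<close>.\<close>
  have "B\<^sup>H * (Jmat n * B) = K - (X + X)"
    by (simp add: B_def mat_alg adj_alg XH rules K_def[symmetric])
  also have "\<dots> = 0\<^sub>m m m" by (intro eq_matI) (auto simp: X_def)
  finally have BB: "B\<^sup>H * (Jmat n * B) = 0\<^sub>m m m" .
  define V where "V = hcat A B"
  have "V \<in> carrier_mat (2*n) (2*m)" by (rule carrier_matI) (simp_all add: V_def)
  moreover have "V\<^sup>H * (Jmat n * V) = Jmat m"
    unfolding V_def by (subst gram_form_hcat) (simp_all add: A B BA BB Jmat_def[of m])
  moreover have "E\<^sup>H * (Jmat n * V) = 0\<^sub>m l (2*m)" "W\<^sup>H * (Jmat n * V) = 0\<^sub>m l (2*m)"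
    by (simp_all add: V_def mult_hcat A B mult_2)
  ultimately show ?thesis using \<open>l \<le> n\<close> unfolding m_def by (intro that)
qed

subsection \<open>The Weierstrass form and the index at infinity\<close>

lemma jordan_matrix_append:
  "jordan_matrix (xs @ ys) = four_block_mat (jordan_matrix xs)
    (0\<^sub>m (sum_list (map fst xs)) (sum_list (map fst ys)))
    (0\<^sub>m (sum_list (map fst ys)) (sum_list (map fst xs))) (jordan_matrix ys)"
  unfolding jordan_matrix_def map_append diag_block_mat_append Let_def
  by (simp only: jordan_matrix_def[symmetric] jordan_matrix_dim)

text \<open>Conjugation by the block permutation that exchanges the summands; it carries a nilpotent
  block past the remaining ones.\<close>

lemma similar_mat_block_swap:
  fixes A :: "'a :: comm_ring_1 mat"
  assumes "A \<in> carrier_mat n n" "D \<in> carrier_mat m m"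
  shows "similar_mat (four_block_mat A (0\<^sub>m n m) (0\<^sub>m m n) D) (four_block_mat D (0\<^sub>m m n) (0\<^sub>m n m) A)"
proof -
  define P :: "'a mat" where "P = four_block_mat (0\<^sub>m n m) (1\<^sub>m n) (1\<^sub>m m) (0\<^sub>m m n)"
  define Q :: "'a mat" where "Q = four_block_mat (0\<^sub>m m n) (1\<^sub>m m) (1\<^sub>m n) (0\<^sub>m n m)"
  define B where "B = four_block_mat D (0\<^sub>m m n) (0\<^sub>m n m) A"
  have [simp]: "dim_row A = n" "dim_col A = n" "dim_row D = m" "dim_col D = m" using assms by auto
  have PB: "P * B = four_block_mat (0\<^sub>m n m) A D (0\<^sub>m m n)"
    unfolding P_def B_def by (subst mult_four_block_mat[of _ n m _ n _ m _ _ m _ n]) (use assms in \<open>simp_all add: mat_alg\<close>)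
  have "P * Q = four_block_mat (1\<^sub>m n) (0\<^sub>m n m) (0\<^sub>m m n) (1\<^sub>m m)"
    unfolding P_def Q_def by (subst mult_four_block_mat[of _ n m _ n _ m _ _ n _ m]) (simp_all add: mat_alg del: four_block_one_mat)
  moreover have "Q * P = four_block_mat (1\<^sub>m m) (0\<^sub>m m n) (0\<^sub>m n m) (1\<^sub>m n)"
    unfolding P_def Q_def by (subst mult_four_block_mat[of _ m n _ m _ n _ _ m _ n]) (simp_all add: mat_alg del: four_block_one_mat)
  moreover have "P * B * Q = four_block_mat A (0\<^sub>m n m) (0\<^sub>m m n) D"
    unfolding PB Q_def by (subst mult_four_block_mat[of _ n m _ n _ m _ _ n _ m]) (use assms in \<open>simp_all add: mat_alg\<close>)
  ultimately have "similar_mat_wit (four_block_mat A (0\<^sub>m n m) (0\<^sub>m m n) D) B P Q"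
    by (intro similar_mat_witI[of _ _ "n + m"])
      (auto simp: P_def Q_def B_def add.commute intro!: carrier_matI)
  then show ?thesis unfolding similar_mat_def B_def by blast
qed

text \<open>Blocks are sorted one at a time: a nonzero eigenvalue goes in front of
  \<open>xs\<close>, a zero one is moved past the rest to the end of \<open>ys\<close>.\<close>

lemma similar_jordan_matrix_partition:
  fixes js :: "(nat \<times> 'a :: field) list"
  shows "\<exists>xs ys. similar_mat (jordan_matrix js) (jordan_matrix (xs @ ys)) \<and>
    (\<forall>(k, a) \<in> set xs. a \<noteq> 0) \<and> (\<forall>(k, a) \<in> set ys. a = 0)"
proof (induction js)
  case Nil
  show ?case by (intro exI[of _ "[]"]) (auto intro!: similar_mat_refl[of _ 0] carrier_matI)
next
  case (Cons p js)
  obtain k a where p: "p = (k, a)" by force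
  from Cons obtain xs ys where s: "similar_mat (jordan_matrix js) (jordan_matrix (xs @ ys))"
    "\<forall>(k, a) \<in> set xs. a \<noteq> 0" "\<forall>(k, a) \<in> set ys. a = 0" by blast
  define m where "m = sum_list (map fst js)"
  from similar_matD[OF s(1)] obtain n where
    "jordan_matrix js \<in> carrier_mat n n" "jordan_matrix (xs @ ys) \<in> carrier_mat n n" by auto
  from this[THEN carrier_matD(1)] have m: "sum_list (map fst xs) + sum_list (map fst ys) = m" by (simp add: m_def)
  define J where "J = jordan_matrix (xs @ ys)"
  have J: "J \<in> carrier_mat m m" by (rule carrier_matI) (simp_all add: J_def m)
  have sim: "similar_mat (jordan_matrix (p # js))
      (four_block_mat (jordan_block k a) (0\<^sub>m k m) (0\<^sub>m m k) J)" (is "similar_mat ?A ?B")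
    unfolding p jordan_matrix_Cons m_def J_def
    by (intro similar_mat_four_block_0_0 s(1) similar_mat_refl) auto
  show ?case
  proof (cases "a = 0")
    case False
    have "?B = jordan_matrix ((p # xs) @ ys)"
      by (simp add: jordan_matrix_Cons p J_def m)
    then show ?thesis using sim s False p by (intro exI[of _ "p # xs"] exI[of _ ys]) auto
  next
    case True
    have "similar_mat ?B (four_block_mat J (0\<^sub>m m k) (0\<^sub>m k m) (jordan_block k a))"
      by (intro similar_mat_block_swap J) auto
    also have "four_block_mat J (0\<^sub>m m k) (0\<^sub>m k m) (jordan_block k a) = jordan_matrix (xs @ ys @ [p])"
    proof -
      have "jordan_matrix [p] = jordan_block k a"
        by (simp only: jordan_matrix_def list.map p prod.case diag_block_mat_singleton)
      then show ?thesis using m jordan_matrix_append[of "xs @ ys" "[p]"] by (simp add: J_def p)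
    qed
    finally have "similar_mat ?A (jordan_matrix (xs @ ys @ [p]))"
      using similar_mat_trans[OF sim] by blast
    then show ?thesis using s True p by (intro exI[of _ xs] exI[of _ "ys @ [p]"]) auto
  qed
qed

lemma det_jordan_matrix_nonzero:
  fixes js :: "(nat \<times> 'a :: field) list"
  assumes "\<forall>(k, a) \<in> set js. a \<noteq> 0"
  shows "det (jordan_matrix js) \<noteq> 0"
  using assms
proof (induction js)
  case Nil
  then show ?case by (simp add: jordan_matrix_def)
next
  case (Cons p js)
  obtain k a where p: "p = (k, a)" by force
  have "det (jordan_block k a) = a ^ k"
    by (subst det_upper_triangular[of _ k]) (auto simp: prod_list_diag_prod)
  then have "det (jordan_block k a) \<noteq> 0" using Cons.prems p by auto
  moreover have "det (jordan_matrix (p # js)) = det (jordan_block k a) * det (jordan_matrix js)"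
    unfolding p jordan_matrix_Cons by (subst det_four_block_mat_lower_left_zero) auto
  ultimately show ?case using Cons by auto
qed

text \<open>The total size bounds the size of every block, and a nilpotent block vanishes at any
  power at least its size.\<close>

lemma nilpotent_jordan_matrix:
  assumes "\<forall>(k, a) \<in> set js. a = (0 :: 'a :: field)" "sum_list (map fst js) \<le> \<nu>"
  shows "jordan_matrix js ^\<^sub>m \<nu> = 0\<^sub>m (sum_list (map fst js)) (sum_list (map fst js))"
  using assms
proof (induction js)
  case Nil
  then show ?case by (intro eq_matI) auto
next
  case (Cons p js)
  obtain k where p: "p = (k, 0)" using Cons.prems by (cases p) auto
  have "jordan_block k 0 ^\<^sub>m \<nu> = (0\<^sub>m k k :: 'a mat)"
    unfolding jordan_block_zero_pow using Cons.prems p by (intro eq_matI) auto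
  then show ?case
    unfolding p jordan_matrix_Cons
    using Cons by (subst pow_four_block_mat) auto
qed

section \<open>Inverses and nilpotent perturbations of the identity\<close>

lemma inverse_of_det:
  fixes A :: "'a :: field mat"
  assumes "A \<in> carrier_mat n n" "det A \<noteq> 0"
  obtains B where "B \<in> carrier_mat n n" "A * B = 1\<^sub>m n" "B * A = 1\<^sub>m n"
  using det_non_zero_imp_unit[OF assms, of undefined]
  unfolding Units_def by (auto simp: ring_mat_simps)

lemma invertible_matI:
  fixes A :: "'a :: field mat"
  assumes "A \<in> carrier_mat n n" "B \<in> carrier_mat n n" "A * B = 1\<^sub>m n"
  shows "invertible_mat A"
  using assms mat_mult_left_right_inverse[OF assms]
  unfolding invertible_mat_def inverts_mat_def by auto

text \<open>Injectivity by descent: on a kernel vector each power of \<open>N\<close> is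
  \<open>- z\<close> times the next power, so vanishing passes from the power \<open>\<nu>\<close>
  down to the vector itself.\<close>

lemma one_plus_nilpotent_inverse:
  fixes N :: "complex mat"
  assumes "N \<in> carrier_mat n n" "N ^\<^sub>m \<nu> = 0\<^sub>m n n"
  obtains B where "B \<in> carrier_mat n n" "B * (1\<^sub>m n + z \<cdot>\<^sub>m N) = 1\<^sub>m n"
proof -
  have [simp]: "dim_row N = n" "dim_col N = n" using assms by auto
  have "X = 0\<^sub>m n k" if X: "X \<in> carrier_mat n k" and eq: "(1\<^sub>m n + z \<cdot>\<^sub>m N) * X = 0\<^sub>m n k" for k X
  proof -
    have [simp]: "dim_row X = n" "dim_col X = k" using X by auto
    have "N ^\<^sub>m (\<nu> - j) * X = 0\<^sub>m n k" for j
    proof (induction j)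
      case 0
      show ?case using assms by (simp add: mat_alg)
    next
      case (Suc j)
      show ?case
      proof (cases "j < \<nu>")
        case True
        then have S: "\<nu> - j = Suc (\<nu> - Suc j)" by simp
        have "N ^\<^sub>m (\<nu> - Suc j) * ((1\<^sub>m n + z \<cdot>\<^sub>m N) * X) =
            N ^\<^sub>m (\<nu> - Suc j) * X + z \<cdot>\<^sub>m (N ^\<^sub>m (\<nu> - j) * X)"
          unfolding S by (simp add: mat_alg smult_mult_dim)
        then show ?thesis using Suc eq by (simp add: mat_alg)
      qed (use Suc in simp)
    qed
    from this[of \<nu>] show ?thesis by (simp add: mat_alg)
  qed
  then show ?thesis
    using left_inverse_exists[of "1\<^sub>m n + z \<cdot>\<^sub>m N" n n] that assms(1) by auto
qed

lemma pow_mult_commuting_nilpotent: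
  fixes N :: "'a :: comm_ring_1 mat"
  assumes "N \<in> carrier_mat n n" "B \<in> carrier_mat n n" "N * B = B * N" "N ^\<^sub>m \<nu> = 0\<^sub>m n n"
  shows "(B * N) ^\<^sub>m \<nu> = 0\<^sub>m n n"
proof -
  have [simp]: "dim_row N = n" "dim_col N = n" "dim_row B = n" "dim_col B = n" using assms by auto
  have comm: "N ^\<^sub>m j * B = B * N ^\<^sub>m j" for j
  proof (induction j)
    case (Suc j)
    have "N ^\<^sub>m Suc j * B = N ^\<^sub>m j * (B * N)" by (simp add: mat_alg assms(3))
    also have "\<dots> = B * N ^\<^sub>m Suc j" by (subst mult2_eq_left[OF Suc]) (simp_all add: mat_alg)
    finally show ?case .
  qed (simp add: mat_alg)
  have "(B * N) ^\<^sub>m j = B ^\<^sub>m j * N ^\<^sub>m j" for j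
  proof (induction j)
    case (Suc j)
    have "(B * N) ^\<^sub>m Suc j = B ^\<^sub>m j * (N ^\<^sub>m j * (B * N))"
      by (simp add: Suc mat_alg)
    also have "\<dots> = B ^\<^sub>m Suc j * N ^\<^sub>m Suc j"
      by (subst mult2_eq_left[OF comm]) (simp_all add: mat_alg)
    finally show ?case .
  qed (simp add: mat_alg)
  then show ?thesis using assms by (simp add: mat_alg)
qed

lemma mult_diag_block:
  fixes A :: "'a :: semiring_1 mat"
  assumes "A \<in> carrier_mat k k" "B \<in> carrier_mat k k" "C \<in> carrier_mat e e" "D \<in> carrier_mat e e"
  shows "four_block_mat A (0\<^sub>m k e) (0\<^sub>m e k) C * four_block_mat B (0\<^sub>m k e) (0\<^sub>m e k) D =
    four_block_mat (A * B) (0\<^sub>m k e) (0\<^sub>m e k) (C * D)"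
  by (subst mult_four_block_mat[of _ k k _ e _ e _ _ k _ e]) (use assms in auto)

text \<open>\<open>ind_inf\<close> is a \<open>LEAST\<close>, so a bound on it says nothing until some canonical form is known to exist.
  It is read off the Jordan form of \<open>(M - z L)\<inverse> L\<close>, whose blocks for nonzero eigenvalues belong to the
  finite part of the pencil and whose nilpotent blocks belong to infinity.\<close>

lemma weierstrass_form_exists:
  assumes M: "M \<in> carrier_mat d d" and L: "L \<in> carrier_mat d d" and reg: "regular_pair M L"
  shows "\<exists>\<nu> P Q js N.
     (let d = dim_row M; k = sum_list (map fst js) in
       P \<in> carrier_mat d d \<and> Q \<in> carrier_mat d d \<and> invertible_mat P \<and> invertible_mat Q \<and>
       k \<le> d \<and> N \<in> carrier_mat (d - k) (d - k) \<and>
       P * M * Q = four_block_mat (jordan_matrix js) (0\<^sub>m k (d - k)) (0\<^sub>m (d - k) k) (1\<^sub>m (d - k)) \<and>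
       P * L * Q = four_block_mat (1\<^sub>m k) (0\<^sub>m k (d - k)) (0\<^sub>m (d - k) k) N \<and>
       N ^\<^sub>m \<nu> = 0\<^sub>m (d - k) (d - k))"
proof -
  have [simp]: "dim_row M = d" "dim_col M = d" "dim_row L = d" "dim_col L = d" using M L by auto
  obtain z where z: "det (M - z \<cdot>\<^sub>m L) \<noteq> 0" using reg by (auto simp: regular_pair_def)
  define A where "A = M - z \<cdot>\<^sub>m L"
  have A: "A \<in> carrier_mat d d" by (rule carrier_matI) (simp_all add: A_def)
  obtain W where W: "W \<in> carrier_mat d d" "A * W = 1\<^sub>m d" "W * A = 1\<^sub>m d"
    using inverse_of_det[OF A] z A_def by metis
  have [simp]: "dim_row A = d" "dim_col A = d" "dim_row W = d" "dim_col W = d" using A W by auto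
  \<comment> \<open>Multiplication by \<open>W\<close> turns \<open>L\<close> into \<open>T\<close>
    and \<open>M\<close> into \<open>1 + z T\<close>, so a Jordan form of \<open>T\<close> splits
    both at once.\<close>
  define T where "T = W * L"
  have T: "T \<in> carrier_mat d d" by (rule carrier_matI) (simp_all add: T_def)
  obtain js where "jordan_nf T js"
    using jordan_nf_exists[OF T] char_poly_factorized[OF T] by blast
  moreover obtain xs ys where xy: "similar_mat (jordan_matrix js) (jordan_matrix (xs @ ys))"
    "\<forall>(k, a) \<in> set xs. a \<noteq> 0" "\<forall>(k, a) \<in> set ys. a = 0"
    using similar_jordan_matrix_partition by blast
  ultimately have "similar_mat T (jordan_matrix (xs @ ys))"
    using similar_mat_trans unfolding jordan_nf_def by blast
  then obtain S S' where "similar_mat_wit T (jordan_matrix (xs @ ys)) S S'"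
    unfolding similar_mat_def by blast
  note S = similar_mat_witD2[OF T this]
  define J1 J2 where "J1 = jordan_matrix xs" and "J2 = jordan_matrix ys"
  define k e where ke: "k = sum_list (map fst xs)" "e = sum_list (map fst ys)"
  have d: "d = k + e" using S(5)[THEN carrier_matD(1)] by (simp add: ke)
  have J: "J1 \<in> carrier_mat k k" "J2 \<in> carrier_mat e e"
    by (rule carrier_matI; simp add: J1_def J2_def ke)+
  have [simp]: "dim_row J1 = k" "dim_col J1 = k" "dim_row J2 = e" "dim_col J2 = e"
    "dim_row S = d" "dim_col S = d" "dim_row S' = d" "dim_col S' = d" using J S by auto
  define JJ where "JJ = four_block_mat J1 (0\<^sub>m k e) (0\<^sub>m e k) J2"
  have [simp]: "dim_row JJ = d" "dim_col JJ = d" by (simp_all add: JJ_def d)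
  have TS: "T = S * (JJ * S')"
    using S(3) by (simp add: jordan_matrix_append JJ_def J1_def J2_def ke mult_assoc_dim d)
  obtain J1' where J1': "J1' \<in> carrier_mat k k" "J1 * J1' = 1\<^sub>m k" "J1' * J1 = 1\<^sub>m k"
    using inverse_of_det[OF J(1)] det_jordan_matrix_nonzero[OF xy(2)] J1_def by metis
  have nil: "J2 ^\<^sub>m e = 0\<^sub>m e e"
    unfolding J2_def ke using nilpotent_jordan_matrix[OF xy(3)] by auto
  \<comment> \<open>On the nilpotent block \<open>M\<close> acts as \<open>1 + z J2\<close>;
    dividing by it makes \<open>M\<close> the identity and turns \<open>L\<close> into
    \<open>B * J2\<close>.\<close>
  obtain B where B: "B \<in> carrier_mat e e" "B * (1\<^sub>m e + z \<cdot>\<^sub>m J2) = 1\<^sub>m e"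
    using one_plus_nilpotent_inverse[OF J(2) nil] by blast
  have [simp]: "dim_row J1' = k" "dim_col J1' = k" "dim_row B = e" "dim_col B = e" using J1' B by auto
  have B': "(1\<^sub>m e + z \<cdot>\<^sub>m J2) * B = 1\<^sub>m e"
    by (rule left_right_inverse[OF B(2)]) simp_all
  define N where "N = B * J2"
  have N: "N \<in> carrier_mat e e" by (rule carrier_matI) (simp_all add: N_def)
  have "J2 * B = B * J2"
  proof -
    have "J2 * B = B * ((1\<^sub>m e + z \<cdot>\<^sub>m J2) * (J2 * B))"
      by (subst mult2_eq_left[OF B(2)]) (simp_all add: mat_alg)
    also have "\<dots> = B * (J2 * ((1\<^sub>m e + z \<cdot>\<^sub>m J2) * B))"
      by (simp add: mat_alg smult_mult_dim)
    also have "\<dots> = B * J2" unfolding B' by (simp add: mat_alg)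
    finally show ?thesis .
  qed
  then have N\<nu>: "N ^\<^sub>m e = 0\<^sub>m e e"
    unfolding N_def using pow_mult_commuting_nilpotent[OF J(2) B(1)] nil by blast
  \<comment> \<open>On the invertible block, dividing by \<open>J1\<close> makes \<open>L\<close>
    the identity and leaves \<open>J1' + z\<close> for \<open>M\<close>, which a second Jordan form
    normalizes.\<close>
  define V where "V = J1' + z \<cdot>\<^sub>m 1\<^sub>m k"
  have V: "V \<in> carrier_mat k k" by (rule carrier_matI) (simp_all add: V_def)
  obtain vs where "jordan_nf V vs"
    using jordan_nf_exists[OF V] char_poly_factorized[OF V] by blast
  then obtain R R' where "similar_mat_wit V (jordan_matrix vs) R R'"
    unfolding jordan_nf_def similar_mat_def by blast
  note R = similar_mat_witD2[OF V this]
  have [simp]: "dim_row R = k" "dim_col R = k" "dim_row R' = k" "dim_col R' = k" using R by auto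
  have k: "sum_list (map fst vs) = k" using R(5)[THEN carrier_matD(1)] by simp
  have RVR: "R' * (V * R) = jordan_matrix vs"
    unfolding R(3) using R(2) k
    by (simp add: mult_assoc_dim mult2_eq_left[OF R(2)] one_mult_dim)
  define diag where "diag X Y = four_block_mat X (0\<^sub>m k e) (0\<^sub>m e k) Y" for X Y :: "complex mat"
  have diag_mult: "diag X1 Y1 * diag X2 Y2 = diag (X1 * X2) (Y1 * Y2)"
    if "dim_row X1 = k" "dim_col X1 = k" "dim_row X2 = k" "dim_col X2 = k"
      "dim_row Y1 = e" "dim_col Y1 = e" "dim_row Y2 = e" "dim_col Y2 = e" for X1 Y1 X2 Y2
    unfolding diag_def by (rule mult_diag_block) (use that in auto)
  have diag_dim [simp]: "dim_row (diag X Y) = dim_row X + dim_row Y"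
    "dim_col (diag X Y) = dim_col X + dim_col Y" for X Y by (simp_all add: diag_def)
  have JJ: "JJ = diag J1 J2" by (simp add: JJ_def diag_def)
  have one: "diag (1\<^sub>m k) (1\<^sub>m e) = 1\<^sub>m d" by (simp add: diag_def d)
  define P where "P = diag (R' * J1') B * (S' * W)"
  define Q where "Q = S * diag R (1\<^sub>m e)"
  have P: "P \<in> carrier_mat d d" and Q: "Q \<in> carrier_mat d d"
    by (rule carrier_matI; simp add: P_def Q_def d)+
  have [simp]: "dim_row P = d" "dim_col P = d" "dim_row Q = d" "dim_col Q = d" using P Q by auto
  note S'S = S(2) S(2)[THEN mult2_eq_left] and WA = W(2,3) W(2,3)[THEN mult2_eq_left]
  have dd [simp]: "k + e = d" by (simp add: d)
  have PL: "P * (L * Q) = diag (1\<^sub>m k) N"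
  proof -
    have "P * (L * Q) = diag (R' * J1') B * (S' * (T * (S * diag R (1\<^sub>m e))))"
      by (simp add: P_def Q_def T_def mult_assoc_dim)
    also have "\<dots> = diag (R' * J1') B * (JJ * diag R (1\<^sub>m e))"
      unfolding TS by (simp add: mult_assoc_dim S'S one_mult_dim)
    also have "\<dots> = diag (1\<^sub>m k) N"
      unfolding JJ using J1'(3) R(2)
      by (simp add: diag_mult mult_assoc_dim one_mult_dim N_def mult2_eq_left[OF J1'(3)])
    finally show ?thesis .
  qed
  have PM: "P * (M * Q) = diag (jordan_matrix vs) (1\<^sub>m e)"
  proof -
    have "M = A + z \<cdot>\<^sub>m L" unfolding A_def by (intro eq_matI) auto
    then have "W * M = 1\<^sub>m d + z \<cdot>\<^sub>m T"
      by (simp add: mult_add_dim smult_mult_dim W T_def)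
    then have WMQ: "W * (M * Q) = (1\<^sub>m d + z \<cdot>\<^sub>m T) * Q" by (rule mult2_eq_left) simp_all
    have "P * (M * Q) = diag (R' * J1') B * (S' * (W * (M * Q)))"
      by (simp add: P_def mult_assoc_dim)
    also have "\<dots> = diag (R' * J1') B * (diag R (1\<^sub>m e) + z \<cdot>\<^sub>m (JJ * diag R (1\<^sub>m e)))"
      unfolding WMQ unfolding TS Q_def
      by (simp add: mult_assoc_dim S'S one_mult_dim add_mult_dim mult_add_dim smult_mult_dim)
    also have "diag R (1\<^sub>m e) + z \<cdot>\<^sub>m (JJ * diag R (1\<^sub>m e)) =
        diag (R + z \<cdot>\<^sub>m (J1 * R)) (1\<^sub>m e + z \<cdot>\<^sub>m J2)"
      unfolding JJ by (simp add: diag_mult one_mult_dim) (intro eq_matI; auto simp: diag_def d simp del: dd)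
    also have "diag (R' * J1') B * \<dots> = diag (R' * (V * R)) (1\<^sub>m e)"
      by (simp add: diag_mult B(2) V_def mult_assoc_dim mult_add_dim add_mult_dim smult_mult_dim
          mult2_eq_left[OF J1'(3)] one_mult_dim)
    finally show ?thesis by (simp add: RVR)
  qed
  have iP: "invertible_mat P"
  proof (rule invertible_matI[OF P])
    show "A * (S * diag (J1 * R) (1\<^sub>m e + z \<cdot>\<^sub>m J2)) \<in> carrier_mat d d"
      by (rule carrier_matI) simp_all
    have "P * (A * (S * diag (J1 * R) (1\<^sub>m e + z \<cdot>\<^sub>m J2))) =
        diag (R' * J1') B * diag (J1 * R) (1\<^sub>m e + z \<cdot>\<^sub>m J2)"
      by (simp add: P_def mult_assoc_dim S'S WA one_mult_dim)
    also have "\<dots> = 1\<^sub>m d" using R(2)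
      by (simp add: diag_mult B(2) mult_assoc_dim mult2_eq_left[OF J1'(3)] one_mult_dim one)
    finally show "P * (A * (S * diag (J1 * R) (1\<^sub>m e + z \<cdot>\<^sub>m J2))) = 1\<^sub>m d" .
  qed
  have iQ: "invertible_mat Q"
  proof (rule invertible_matI[OF Q])
    show "diag R' (1\<^sub>m e) * S' \<in> carrier_mat d d" by (rule carrier_matI) simp_all
    have "diag R (1\<^sub>m e) * (diag R' (1\<^sub>m e) * S') = 1\<^sub>m d * S'"
      by (rule mult2_eq_left) (simp_all add: diag_mult R(1) one_mult_dim one)
    then show "Q * (diag R' (1\<^sub>m e) * S') = 1\<^sub>m d"
      using S(1) by (simp add: Q_def mult_assoc_dim one_mult_dim)
  qed
  have "d - k = e" "k \<le> d" using d by linarith+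
  then show ?thesis
    using P Q iP iQ N N\<nu> PM PL k
    by (intro exI[of _ e] exI[of _ P] exI[of _ Q] exI[of _ vs] exI[of _ N])
      (simp add: Let_def mult_assoc_dim diag_def)
qed

text \<open>A nonzero \<open>X\<close> excluded here is the start of a Jordan chain of length two at infinity.\<close>
lemma ind_inf_le_1_no_chain:
  assumes M: "M \<in> carrier_mat d d" and L: "L \<in> carrier_mat d d" and reg: "regular_pair M L"
    and ind: "ind_inf M L \<le> 1"
    and X: "X \<in> carrier_mat d c" "L * X = 0\<^sub>m d c"
    and W: "W \<in> carrier_mat d c" "M * X = L * W"
  shows "X = 0\<^sub>m d c"
proof -
  have [simp]: "dim_row M = d" "dim_col M = d" "dim_row L = d" "dim_col L = d"
    "dim_row X = d" "dim_col X = c" "dim_row W = d" "dim_col W = c" using M L X W by auto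
  obtain P Q js N k e where P: "P \<in> carrier_mat d d" and Q: "Q \<in> carrier_mat d d" "invertible_mat Q"
    and ke: "k = sum_list (map fst js)" "d = k + e" and N: "N \<in> carrier_mat e e"
    and PM: "P * M * Q = four_block_mat (jordan_matrix js) (0\<^sub>m k e) (0\<^sub>m e k) (1\<^sub>m e)"
    and PL: "P * L * Q = four_block_mat (1\<^sub>m k) (0\<^sub>m k e) (0\<^sub>m e k) N"
    and nil: "N ^\<^sub>m (ind_inf M L) = 0\<^sub>m e e"
    using LeastI_ex[OF weierstrass_form_exists[OF M L reg], folded ind_inf_def]
    unfolding Let_def carrier_matD[OF M]
    by (elim exE conjE) (metis le_add_diff_inverse)
  have [simp]: "dim_row P = d" "dim_col P = d" "dim_row Q = d" "dim_col Q = d"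
    "dim_row N = e" "dim_col N = e" using P Q N by auto
  \<comment> \<open>Exponent zero makes the identity of the block at infinity zero, hence
    \<open>N\<close> too; exponent one says it outright.\<close>
  have "N = 0\<^sub>m e e"
  proof (cases "ind_inf M L")
    case 0
    then have "1\<^sub>m e = (0\<^sub>m e e :: complex mat)" using nil by simp
    then have "N * 1\<^sub>m e = N * 0\<^sub>m e e" by simp
    then show ?thesis by (simp add: mat_alg)
  next
    case (Suc j)
    then show ?thesis using nil ind by (simp add: mat_alg)
  qed
  obtain Q' where Q': "Q' \<in> carrier_mat d d" "Q * Q' = 1\<^sub>m d"
    using Q unfolding invertible_mat_def inverts_mat_def
    by (metis \<open>dim_col Q = d\<close> \<open>dim_row Q = d\<close> carrier_matI index_mult_mat(3) index_one_mat(3) index_mult_mat(2) index_one_mat(2))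
  have [simp]: "dim_row Q' = d" "dim_col Q' = d" using Q' by auto
  \<comment> \<open>\<open>Z\<close> projects onto the block at infinity. With \<open>N = 0\<close>
    it is complementary to \<open>P * L * Q\<close>, so \<open>L * X = 0\<close> puts
    \<open>Q' * X\<close> in that block; there \<open>M\<close> acts as the identity, while
    \<open>Z\<close> annihilates the \<open>L\<close> side of \<open>M * X = L * W\<close>.\<close>
  define Z where "Z = four_block_mat (0\<^sub>m k k) (0\<^sub>m k e) (0\<^sub>m e k) (1\<^sub>m e :: complex mat)"
  have [simp]: "dim_row Z = d" "dim_col Z = d" by (simp_all add: Z_def ke(2) del: four_block_zero_mat)
  have J: "jordan_matrix js \<in> carrier_mat k k" using ke(1) by simp
  have ZM: "Z * (P * (M * Q)) = Z" and ZL: "Z * (P * (L * Q)) = 0\<^sub>m d d"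
    and LZ: "P * (L * Q) + Z = 1\<^sub>m d"
  proof -
    have "Z * (P * M * Q) = Z"
      unfolding PM Z_def by (subst mult_diag_block) (use J in \<open>simp_all add: mat_alg left_mult_zero_mat[OF J]\<close>)
    moreover have "Z * (P * L * Q) = 0\<^sub>m d d"
      unfolding PL \<open>N = _\<close> Z_def by (subst mult_diag_block) (simp_all add: mat_alg ke(2))
    moreover have "P * L * Q + Z = 1\<^sub>m d"
      unfolding PL \<open>N = _\<close> Z_def by (intro eq_matI) (auto simp: ke(2))
    ultimately show "Z * (P * (M * Q)) = Z" "Z * (P * (L * Q)) = 0\<^sub>m d d" "P * (L * Q) + Z = 1\<^sub>m d"
      by (simp_all add: mult_assoc_dim)
  qed
  have QQ: "Q * (Q' * Y) = Y" if "dim_row Y = d" for Y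
    using that by (subst mult2_eq_left[OF Q'(2)]) (simp_all add: mat_alg)
  have "Q' * X = (P * (L * Q) + Z) * (Q' * X)" unfolding LZ by (simp add: mat_alg)
  also have "\<dots> = Z * (Q' * X)" by (simp add: mat_alg QQ X)
  also have "\<dots> = (Z * (P * (M * Q))) * (Q' * X)" unfolding ZM ..
  also have "\<dots> = (Z * (P * (L * Q))) * (Q' * W)" by (simp add: mult_assoc_dim QQ W(2))
  also have "\<dots> = 0\<^sub>m d c" unfolding ZL by (simp add: mat_alg)
  finally show ?thesis using QQ[of X] by (simp add: mat_alg)
qed

subsection \<open>Symplectic pairs\<close>

text \<open>If the rows of \<open>Y\<close> annihilate \<open>M\<close>, then \<open>L J L\<^sup>H Y\<^sup>H = M J M\<^sup>H Y\<^sup>H = 0\<close>, so \<open>J L\<^sup>H Y\<^sup>H\<close> lies in the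
  kernel of \<open>L\<close>; regularity keeps it of full column rank. The invertible combination \<open>a M + b L\<close> is kept
  general because the roles of \<open>M\<close> and \<open>L\<close> are exchanged later.\<close>

lemma symplectic_pair_null_space:
  assumes c: "M \<in> carrier_mat (2*n) (2*n)" "L \<in> carrier_mat (2*n) (2*n)" "W \<in> carrier_mat (2*n) (2*n)"
      "Y \<in> carrier_mat s (2*n)" "H \<in> carrier_mat (2*n) s"
    and symp: "M * (Jmat n * M\<^sup>H) = L * (Jmat n * L\<^sup>H)"
    and inv: "(a \<cdot>\<^sub>m M + b \<cdot>\<^sub>m L) * W = 1\<^sub>m (2*n)"
    and YM: "Y * M = 0\<^sub>m s (2*n)" and YH: "Y * H = 1\<^sub>m s"
    and E: "E = Jmat n * (L\<^sup>H * Y\<^sup>H)"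
  shows "L * E = 0\<^sub>m (2*n) s" "E\<^sup>H * (Jmat n * E) = 0\<^sub>m s s"
    "E\<^sup>H * Jmat n = Y * L" "\<exists>F. F \<in> carrier_mat s (2*n) \<and> F * E = 1\<^sub>m s"
proof -
  have [simp]: "dim_row M = 2*n" "dim_col M = 2*n" "dim_row L = 2*n" "dim_col L = 2*n"
    "dim_row W = 2*n" "dim_col W = 2*n" "dim_row Y = s" "dim_col Y = 2*n" "dim_row H = 2*n" "dim_col H = s"
    using c by auto
  have [simp]: "dim_row E = 2*n" "dim_col E = s" by (simp_all add: E)
  have MY: "M\<^sup>H * Y\<^sup>H = 0\<^sub>m (2*n) s" using YM by (simp flip: adjoint_mult_dim)
  have "L * E = L * (Jmat n * (L\<^sup>H * Y\<^sup>H))" by (simp add: E)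
  also have "\<dots> = M * (Jmat n * (M\<^sup>H * Y\<^sup>H))"
    by (simp add: mult3_eq_left[OF symp[symmetric]] mult_assoc_dim)
  also have "\<dots> = 0\<^sub>m (2*n) s" by (simp add: MY mat_alg)
  finally show LE: "L * E = 0\<^sub>m (2*n) s" .
  show EJ: "E\<^sup>H * Jmat n = Y * L"
    by (simp add: E adj_alg mat_alg Jmat_square)
  have "E\<^sup>H * (Jmat n * E) = Y * (L * E)"
    by (subst mult2_eq_left[OF EJ]) (simp_all add: mult_assoc_dim)
  then show "E\<^sup>H * (Jmat n * E) = 0\<^sub>m s s" by (simp add: LE mat_alg)
  \<comment> \<open>By \<open>EJ\<close>, pairing \<open>E\<close> with \<open>G\<close> gives
    \<open>Y * (b L) * W * H\<close>. Since \<open>Y * M = 0\<close>, \<open>a M\<close> can be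
    added, and \<open>W\<close> then cancels the combination, leaving \<open>Y * H\<close>.\<close>
  define G where "G = Jmat n * (b \<cdot>\<^sub>m (W * H))"
  have [simp]: "dim_row G = 2*n" "dim_col G = s" by (simp_all add: G_def)
  have "E\<^sup>H * G = Y * ((a \<cdot>\<^sub>m M + b \<cdot>\<^sub>m L) * (W * H))"
    unfolding G_def by (subst mult2_eq_left[OF EJ])
      (simp_all add: mat_alg smult_mult_dim YM mult2_eq_left[OF YM])
  also have "\<dots> = 1\<^sub>m s"
    by (subst mult2_eq_left[OF inv]) (simp_all add: mat_alg YH)
  finally have "E\<^sup>H * G = 1\<^sub>m s" .
  then have "G\<^sup>H * E = 1\<^sub>m s"
    using adjoint_mult_dim[of "E\<^sup>H" G] by simp
  then show "\<exists>F. F \<in> carrier_mat s (2*n) \<and> F * E = 1\<^sub>m s"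
    by (intro exI[of _ "G\<^sup>H"]) (auto intro: carrier_matI)
qed

text \<open>On the kernel of \<open>A\<close> the splitting of the identity collapses to
  \<open>K * G\<close>, so \<open>G * X\<close> gives the coordinates of \<open>X\<close> along the
  columns of \<open>K\<close>.\<close>

lemma null_space_factor:
  fixes A :: "complex mat"
  assumes A: "dim_row A = m" "dim_col A = p" and K: "K \<in> carrier_mat p q" "G \<in> carrier_mat q p"
    and LD: "L \<in> carrier_mat r m" "D \<in> carrier_mat p r" "D * (L * A) + K * G = 1\<^sub>m p"
    and X: "X \<in> carrier_mat p s" "A * X = 0\<^sub>m m s"
  shows "K * (G * X) = X"
proof -
  have [simp]: "dim_row K = p" "dim_col K = q" "dim_row G = q" "dim_col G = p" "dim_row L = r" "dim_col L = m"
    "dim_row D = p" "dim_col D = r" "dim_row X = p" "dim_col X = s" using K LD X by auto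
  have "(D * (L * A) + K * G) * X = K * (G * X)"
    by (simp add: A mat_alg X(2))
  then show ?thesis unfolding LD(3) by (simp add: mat_alg)
qed

text \<open>\<open>E\<close> has full column rank, one column for each dimension of the left kernel
  of \<open>M\<close>, and lies in the kernel of \<open>L\<close>; hence the nullity of
  \<open>L\<close> is at least that of \<open>M\<close>.\<close>

lemma symplectic_pair_rank_le:
  assumes c: "M \<in> carrier_mat (2*n) (2*n)" "L \<in> carrier_mat (2*n) (2*n)" "W \<in> carrier_mat (2*n) (2*n)"
    and symp: "M * (Jmat n * M\<^sup>H) = L * (Jmat n * L\<^sup>H)"
    and inv: "(a \<cdot>\<^sub>m M + b \<cdot>\<^sub>m L) * W = 1\<^sub>m (2*n)"
  shows "vec_space.rank (2*n) L \<le> vec_space.rank (2*n) M"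
proof -
  obtain r P D K G H Y where r: "r \<le> 2*n" "r \<le> 2*n" "vec_space.rank (2*n) M = r"
    and cM: "P \<in> carrier_mat r (2*n)" "D \<in> carrier_mat (2*n) r" "K \<in> carrier_mat (2*n) (2*n - r)"
      "G \<in> carrier_mat (2*n - r) (2*n)" "H \<in> carrier_mat (2*n) (2*n - r)" "Y \<in> carrier_mat (2*n - r) (2*n)"
    and sM: "P * (M * D) = 1\<^sub>m r" "M * K = 0\<^sub>m (2*n) (2*n - r)" "G * K = 1\<^sub>m (2*n - r)"
      "Y * M = 0\<^sub>m (2*n - r) (2*n)" "Y * H = 1\<^sub>m (2*n - r)" "D * (P * M) + K * G = 1\<^sub>m (2*n)"
      "M * (D * P) + H * Y = 1\<^sub>m (2*n)"
    by (rule kernel_range_split[OF c(1)])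
  obtain r' P' D' K' G' H' Y' where r': "r' \<le> 2*n" "r' \<le> 2*n" "vec_space.rank (2*n) L = r'"
    and cL: "P' \<in> carrier_mat r' (2*n)" "D' \<in> carrier_mat (2*n) r'" "K' \<in> carrier_mat (2*n) (2*n - r')"
      "G' \<in> carrier_mat (2*n - r') (2*n)" "H' \<in> carrier_mat (2*n) (2*n - r')" "Y' \<in> carrier_mat (2*n - r') (2*n)"
    and sL: "P' * (L * D') = 1\<^sub>m r'" "L * K' = 0\<^sub>m (2*n) (2*n - r')" "G' * K' = 1\<^sub>m (2*n - r')"
      "Y' * L = 0\<^sub>m (2*n - r') (2*n)" "Y' * H' = 1\<^sub>m (2*n - r')" "D' * (P' * L) + K' * G' = 1\<^sub>m (2*n)"
      "L * (D' * P') + H' * Y' = 1\<^sub>m (2*n)"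
    by (rule kernel_range_split[OF c(2)])
  define E where "E = Jmat n * (L\<^sup>H * Y\<^sup>H)"
  have cE: "E \<in> carrier_mat (2*n) (2*n - r)"
    unfolding E_def by (rule carrier_matI) (use cM(6) in simp_all)
  note E = symplectic_pair_null_space[OF c cM(6,5) symp inv sM(4,5) E_def]
  obtain F where F: "F \<in> carrier_mat (2*n - r) (2*n)" "F * E = 1\<^sub>m (2*n - r)" using E(4) by blast
  have "K' * (G' * E) = E"
    using c(2) by (intro null_space_factor[of L "2*n" "2*n", OF _ _ cL(3,4,1,2) sL(6) cE E(1)]) auto
  then have "(F * K') * (G' * E) = 1\<^sub>m (2*n - r)"
    using cE F cL by (subst mult_assoc_dim) auto
  then have "2*n - r \<le> 2*n - r'"
    using cE F cL by (intro right_inverse_size[of "F * K'" _ "2*n - r'" "G' * E"]) auto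
  then show ?thesis using r r' by linarith
qed

section \<open>The normal form: dual kernels, symplectic complement, induced symplectic
  matrix\<close>

theorem theorem2p3:
  fixes n :: nat and M L :: "complex mat"
  assumes "M \<in> carrier_mat (2*n) (2*n)" and "L \<in> carrier_mat (2*n) (2*n)"
    and "symplectic_pair n M L" and "regular_pair M L"
    and "ind_inf M L \<le> 1"
  shows "\<exists>nh. nh \<le> n \<and> vec_space.rank (2*n) M = n + nh \<and> vec_space.rank (2*n) L = n + nh \<and>
    (let l = n - nh in
     \<exists>U0 Uinf U1 S.
       U0 \<in> carrier_mat (2*n) l \<and> Uinf \<in> carrier_mat (2*n) l \<and> U1 \<in> carrier_mat (2*n) (2*nh) \<and>
       symplectic_mat nh S \<and>
       (let U = hcat U1 (hcat U0 Uinf) in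
         mat_adjoint U * Jmat n * U =
           four_block_mat (Jmat nh) (0\<^sub>m (2*nh) (2*l)) (0\<^sub>m (2*l) (2*nh)) (Jmat l)) \<and>
       M * U0 = 0\<^sub>m (2*n) l \<and> L * Uinf = 0\<^sub>m (2*n) l \<and> M * U1 = L * U1 * S)"
proof -
  note c = assms(1,2)
  have [simp]: "dim_row M = 2*n" "dim_col M = 2*n" "dim_row L = 2*n" "dim_col L = 2*n"
    using c by auto
  have symp: "M * (Jmat n * M\<^sup>H) = L * (Jmat n * L\<^sup>H)"
    using assms(3) by (simp add: symplectic_pair_def mult_assoc_dim)
  obtain z where "det (M - z \<cdot>\<^sub>m L) \<noteq> 0" using assms(4) by (auto simp: regular_pair_def)
  then obtain W where W: "W \<in> carrier_mat (2*n) (2*n)" "(M - z \<cdot>\<^sub>m L) * W = 1\<^sub>m (2*n)"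
    using inverse_of_det[of "M - z \<cdot>\<^sub>m L" "2*n"] c by (metis minus_carrier_mat smult_carrier_mat)
  have W1: "(1 \<cdot>\<^sub>m M + (- z) \<cdot>\<^sub>m L) * W = 1\<^sub>m (2*n)" and W2: "((- z) \<cdot>\<^sub>m L + 1 \<cdot>\<^sub>m M) * W = 1\<^sub>m (2*n)"
  proof -
    have "1 \<cdot>\<^sub>m M + (- z) \<cdot>\<^sub>m L = M - z \<cdot>\<^sub>m L" "(- z) \<cdot>\<^sub>m L + 1 \<cdot>\<^sub>m M = M - z \<cdot>\<^sub>m L"
      by (intro eq_matI; simp)+
    then show "(1 \<cdot>\<^sub>m M + (- z) \<cdot>\<^sub>m L) * W = 1\<^sub>m (2*n)" "((- z) \<cdot>\<^sub>m L + 1 \<cdot>\<^sub>m M) * W = 1\<^sub>m (2*n)"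
      using W by simp_all
  qed
  have rank_eq: "vec_space.rank (2*n) M = vec_space.rank (2*n) L"
    by (intro antisym symplectic_pair_rank_le[OF c(2,1) W(1) symp[symmetric] W2]
        symplectic_pair_rank_le[OF c W(1) symp W1])
  obtain r P D K G H Y where r: "r \<le> 2*n" "r \<le> 2*n" "vec_space.rank (2*n) M = r"
    and cM: "P \<in> carrier_mat r (2*n)" "D \<in> carrier_mat (2*n) r" "K \<in> carrier_mat (2*n) (2*n - r)"
      "G \<in> carrier_mat (2*n - r) (2*n)" "H \<in> carrier_mat (2*n) (2*n - r)" "Y \<in> carrier_mat (2*n - r) (2*n)"
    and sM: "P * (M * D) = 1\<^sub>m r" "M * K = 0\<^sub>m (2*n) (2*n - r)" "G * K = 1\<^sub>m (2*n - r)"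
      "Y * M = 0\<^sub>m (2*n - r) (2*n)" "Y * H = 1\<^sub>m (2*n - r)" "D * (P * M) + K * G = 1\<^sub>m (2*n)"
      "M * (D * P) + H * Y = 1\<^sub>m (2*n)"
    by (rule kernel_range_split[OF c(1)])
  obtain r' P' D' K' G' H' Y' where r': "r' \<le> 2*n" "r' \<le> 2*n" "vec_space.rank (2*n) L = r'"
    and cL: "P' \<in> carrier_mat r' (2*n)" "D' \<in> carrier_mat (2*n) r'" "K' \<in> carrier_mat (2*n) (2*n - r')"
      "G' \<in> carrier_mat (2*n - r') (2*n)" "H' \<in> carrier_mat (2*n) (2*n - r')" "Y' \<in> carrier_mat (2*n - r') (2*n)"
    and sL: "P' * (L * D') = 1\<^sub>m r'" "L * K' = 0\<^sub>m (2*n) (2*n - r')" "G' * K' = 1\<^sub>m (2*n - r')"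
      "Y' * L = 0\<^sub>m (2*n - r') (2*n)" "Y' * H' = 1\<^sub>m (2*n - r')" "D' * (P' * L) + K' * G' = 1\<^sub>m (2*n)"
      "L * (D' * P') + H' * Y' = 1\<^sub>m (2*n)"
    by (rule kernel_range_split[OF c(2)])
  have "r' = r" using rank_eq r(3) r'(3) by simp
  define l where "l = 2*n - r"
  note cM = cM[folded l_def] and sM = sM[folded l_def]
    and cL = cL[unfolded \<open>r' = r\<close>, folded l_def] and sL = sL[unfolded \<open>r' = r\<close>, folded l_def]
  from cM cL have [simp]: "dim_row Y = l" "dim_col Y = 2*n" "dim_row Y' = l" "dim_col Y' = 2*n"
    "dim_row H' = 2*n" "dim_col H' = l" "dim_row D' = 2*n" "dim_col D' = r" "dim_row P' = r" "dim_col P' = 2*n"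
    "dim_row K' = 2*n" "dim_col K' = l" "dim_row G' = l" "dim_col G' = 2*n" by auto
  define E where "E = Jmat n * (L\<^sup>H * Y\<^sup>H)"
  define E0 where "E0 = Jmat n * (M\<^sup>H * Y'\<^sup>H)"
  note E = symplectic_pair_null_space[OF c(1,2) W(1) cM(6,5) symp W1 sM(4,5) E_def]
  note E0 = symplectic_pair_null_space[OF c(2,1) W(1) cL(6,5) symp[symmetric] W2 sL(4,5) E0_def]
  have [simp]: "dim_row E = 2*n" "dim_col E = l" "dim_row E0 = 2*n" "dim_col E0 = l"
    by (simp_all add: E_def E0_def)
  have cE: "E \<in> carrier_mat (2*n) l" by (rule carrier_matI) simp_all
  obtain F where F: "F \<in> carrier_mat l (2*n)" "F * E = 1\<^sub>m l" using E(4) by blast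
  from F have [simp]: "dim_row F = l" "dim_col F = 2*n" by auto
  have KE: "K' * (G' * E) = E"
    by (rule null_space_factor[of L "2*n" "2*n", OF _ _ cL(3,4,1,2) sL(6) cE E(1)]) simp_all
  have FK: "(F * K') * (G' * E) = 1\<^sub>m l" by (simp add: mult_assoc_dim KE F)
  \<comment> \<open>\<open>G' * E\<close> is square and one-sidedly invertible, hence invertible:
    the columns of \<open>E\<close> span the whole kernel of \<open>L\<close>.\<close>
  have K': "K' = E * (F * K')"
  proof -
    have "(G' * E) * (F * K') = 1\<^sub>m l" by (rule left_right_inverse[OF FK]) simp_all
    then have "K' * ((G' * E) * (F * K')) = K'" by (simp add: one_mult_dim)
    moreover have "K' * ((G' * E) * (F * K')) = (K' * (G' * E)) * (F * K')" by (simp add: mult_assoc_dim)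
    ultimately show ?thesis unfolding KE by simp
  qed
  \<comment> \<open>The rows of \<open>Y'\<close> test membership in the range of \<open>L\<close>,
    and \<open>D' * P'\<close> supplies a preimage.\<close>
  have range_L: "B = L * (D' * (P' * B))" if "dim_row B = 2*n" "Y' * B = 0\<^sub>m l c" for B c
  proof -
    have "dim_col B = c" using arg_cong[OF that(2), of dim_col] by simp
    then have "(L * (D' * P') + H' * Y') * B = L * (D' * (P' * B))"
      using that by (simp add: mult_assoc_dim add_mult_dim zero_mult_dim zero_add_dim)
    then show ?thesis unfolding sL(7) using that by (simp add: one_mult_dim)
  qed
  \<comment> \<open>The pairing of the two kernels. If \<open>R * X = 0\<close>, then
    \<open>E * X\<close> lies in the kernel of \<open>L\<close> and its \<open>M\<close>-image in
    the range of \<open>L\<close>, which the index bound excludes unless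
    \<open>X = 0\<close>.\<close>
  define R where "R = E0\<^sup>H * (Jmat n * E)"
  have [simp]: "dim_row R = l" "dim_col R = l" by (simp_all add: R_def)
  have cR: "R \<in> carrier_mat l l" by (rule carrier_matI) simp_all
  have R: "R = Y' * (M * E)"
    unfolding R_def by (subst mult2_eq_left[OF E0(3)]) (simp_all add: mult_assoc_dim)
  obtain R' where R': "R' \<in> carrier_mat l l" "R' * R = 1\<^sub>m l"
  proof (rule left_inverse_exists[OF cR])
    fix k X assume X: "X \<in> carrier_mat l k" "R * X = 0\<^sub>m l k"
    have [simp]: "dim_row X = l" "dim_col X = k" using X by auto
    have "Y' * (M * (E * X)) = 0\<^sub>m l k" using X(2) by (simp add: R mult_assoc_dim)
    then have MEX: "M * (E * X) = L * (D' * (P' * (M * (E * X))))" by (intro range_L[of _ k]) simp_all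
    have LEX: "L * (E * X) = 0\<^sub>m (2*n) k"
      by (subst mult2_eq_left[OF E(1)]) (simp_all add: zero_mult_dim)
    have "E * X \<in> carrier_mat (2*n) k" "D' * (P' * (M * (E * X))) \<in> carrier_mat (2*n) k"
      by (rule carrier_matI; simp)+
    then have "E * X = 0\<^sub>m (2*n) k"
      using ind_inf_le_1_no_chain[OF c assms(4,5)] LEX MEX by blast
    moreover have "F * (E * X) = X"
      by (subst mult2_eq_left[OF F(2)]) (simp_all add: one_mult_dim)
    ultimately show "X = 0\<^sub>m l k" by (simp add: zero_mult_dim)
  qed
  have [simp]: "dim_row R' = l" "dim_col R' = l" using R' by auto
  have RR': "R * R' = 1\<^sub>m l" by (rule left_right_inverse[OF R'(2)]) simp_all
  \<comment> \<open>Rescaling by the inverse of \<open>R\<close> makes the two kernel bases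
    dual.\<close>
  define Ui where "Ui = E * R'"
  have [simp]: "dim_row Ui = 2*n" "dim_col Ui = l" by (simp_all add: Ui_def)
  have E_Ui: "E = Ui * R" by (simp add: Ui_def mult_assoc_dim R' one_mult_dim)
  have LUi: "L * Ui = 0\<^sub>m (2*n) l"
    unfolding Ui_def by (subst mult2_eq_left[OF E(1)]) (simp_all add: zero_mult_dim)
  have UiUi: "Ui\<^sup>H * (Jmat n * Ui) = 0\<^sub>m l l"
    by (simp add: Ui_def adj_alg mult_assoc_dim mult3_eq_left[OF E(2)] zero_mult_dim)
  have U0Ui: "E0\<^sup>H * (Jmat n * Ui) = 1\<^sub>m l"
    by (simp add: Ui_def mult3_eq_left[OF R_def[symmetric]] RR')
  have cU: "E0 \<in> carrier_mat (2*n) l" "Ui \<in> carrier_mat (2*n) l" by (rule carrier_matI; simp)+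
  obtain V where "l \<le> n" and cV: "V \<in> carrier_mat (2*n) (2*(n-l))" and VV: "V\<^sup>H * (Jmat n * V) = Jmat (n - l)"
    and U0V: "E0\<^sup>H * (Jmat n * V) = 0\<^sub>m l (2*(n-l))" and UiV: "Ui\<^sup>H * (Jmat n * V) = 0\<^sub>m l (2*(n-l))"
    by (rule symplectic_complement[OF cU E0(2) UiUi U0Ui])
  define nh where "nh = n - l"
  have ln: "nh \<le> n" "n - nh = l" "r = n + nh" "nh + l = n"
    using \<open>l \<le> n\<close> r(1) unfolding nh_def l_def by linarith+
  note VV = VV[folded nh_def] and U0V = U0V[folded nh_def] and UiV = UiV[folded nh_def]
    and cV = cV[folded nh_def]
  have [simp]: "dim_row V = 2*n" "dim_col V = 2*nh" using cV by auto
  have VU0: "V\<^sup>H * (Jmat n * E0) = 0\<^sub>m (2*nh) l" "V\<^sup>H * (Jmat n * Ui) = 0\<^sub>m (2*nh) l"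
    "Ui\<^sup>H * (Jmat n * E0) = - 1\<^sub>m l"
    by (subst Jmat_form_swap; simp add: U0V UiV U0Ui add_uminus_dim)+
  define U where "U = hcat V (hcat E0 Ui)"
  define Q where "Q = four_block_mat (Jmat nh) (0\<^sub>m (2*nh) (2*l)) (0\<^sub>m (2*l) (2*nh)) (Jmat l)"
  have [simp]: "dim_row U = 2*n" "dim_col U = 2*n" "dim_row Q = 2*n" "dim_col Q = 2*n"
    using ln by (simp_all add: U_def Q_def)
  have UU: "U\<^sup>H * (Jmat n * U) = Q"
  proof -
    have J: "Jmat n * hcat E0 Ui = hcat (Jmat n * E0) (Jmat n * Ui)" by (simp add: mult_hcat)
    have "(hcat E0 Ui)\<^sup>H * (Jmat n * hcat E0 Ui) = Jmat l"
      by (subst gram_form_hcat) (simp_all add: E0(2) U0Ui VU0 UiUi Jmat_def[of l])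
    moreover have VE: "V\<^sup>H * (Jmat n * hcat E0 Ui) = 0\<^sub>m (2*nh) (2*l)"
      unfolding J by (simp add: mult_hcat VU0 mult_2)
    moreover have "(hcat E0 Ui)\<^sup>H * (Jmat n * V) = 0\<^sub>m (2*l) (2*nh)"
      by (subst Jmat_form_swap) (simp_all add: VE add_uminus_dim)
    ultimately show ?thesis unfolding U_def Q_def by (subst gram_form_hcat) (simp_all add: VV)
  qed
  \<comment> \<open>\<open>T\<close> is \<open>U * Q * U\<^sup>H\<close> written out. It equals the
    form because \<open>T * Jmat n\<close> negates every column of the invertible
    \<open>U\<close>.\<close>
  define T where "T = V * (Jmat nh * V\<^sup>H) + (E0 * Ui\<^sup>H - Ui * E0\<^sup>H)"
  have [simp]: "dim_row T = 2*n" "dim_col T = 2*n" by (simp_all add: T_def)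
  have T: "T = Jmat n"
  proof -
    have n: "2*n = 2*nh + 2*l" using ln(4) by linarith
    have "Q * Q = four_block_mat (- 1\<^sub>m (2*nh)) (0\<^sub>m (2*nh) (2*l)) (0\<^sub>m (2*l) (2*nh)) (- 1\<^sub>m (2*l))"
      unfolding Q_def by (subst mult_diag_block) (simp_all add: Jmat_square)
    also have "\<dots> = - 1\<^sub>m (2*n)" unfolding n by (intro eq_matI) auto
    finally have "(- (Q * (U\<^sup>H * Jmat n))) * U = 1\<^sub>m (2*n)"
      by (simp add: mult_assoc_dim UU uminus_mult_dim)
    then have UR: "U * (- (Q * (U\<^sup>H * Jmat n))) = 1\<^sub>m (2*n)"
      by (rule left_right_inverse) simp_all
    have "T * (Jmat n * V) = - V" "T * (Jmat n * E0) = - E0" "T * (Jmat n * Ui) = - Ui"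
      by (simp_all add: T_def mat_alg VV VU0 U0V UiV U0Ui UiUi E0(2) Jmat_square)
    then have "(T * Jmat n) * U = - U"
      unfolding U_def by (simp add: mult_hcat mult_assoc_dim) (intro eq_matI; auto)
    then have "(T * Jmat n) * (U * (- (Q * (U\<^sup>H * Jmat n)))) = - U * (- (Q * (U\<^sup>H * Jmat n)))"
      by (rule mult2_eq_left) simp_all
    also have "\<dots> = - 1\<^sub>m (2*n)" using UR by (simp add: uminus_mult_dim)
    finally have TJ: "T * Jmat n = - 1\<^sub>m (2*n)" unfolding UR by (simp add: one_mult_dim)
    have "T = - (T * (Jmat n * Jmat n))" by (simp add: Jmat_square mat_alg)
    also have "\<dots> = Jmat n" by (simp add: mult2_eq_left[OF TJ] mat_alg)
    finally show ?thesis .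
  qed
  \<comment> \<open>\<open>Y' * M\<close> is the pairing with \<open>E0\<close>, to which
    \<open>V\<close> is orthogonal, so \<open>M * V\<close> lies in the range of
    \<open>L\<close>.\<close>
  have YMV: "Y' * (M * V) = 0\<^sub>m l (2*nh)"
    using U0V by (simp add: mult2_eq_left[OF E0(3)] mult_assoc_dim)
  define B where "B = D' * (P' * (M * V))"
  have [simp]: "dim_row B = 2*n" "dim_col B = 2*nh" by (simp_all add: B_def)
  have MV: "M * V = L * B" unfolding B_def by (rule range_L[OF _ YMV]) simp
  \<comment> \<open>\<open>S\<close> and \<open>S0\<close> are the coordinates of \<open>B\<close>
    along \<open>V\<close> and \<open>E0\<close> when \<open>B\<close> is expanded through
    \<open>T\<close>; the part along \<open>Ui\<close> is lost under \<open>L\<close>.\<close>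
  define S where "S = - (Jmat nh * (V\<^sup>H * (Jmat n * B)))"
  define S0 where "S0 = - (Ui\<^sup>H * (Jmat n * B))"
  have [simp]: "dim_row S = 2*nh" "dim_col S = 2*nh" "dim_row S0 = l" "dim_col S0 = 2*nh"
    by (simp_all add: S_def S0_def)
  have "B = - (T * (Jmat n * B))"
    unfolding T by (simp add: mult2_eq_left[OF Jmat_square] mat_alg)
  also have "\<dots> = V * S + (E0 * S0 + Ui * (E0\<^sup>H * (Jmat n * B)))"
    by (simp add: T_def S_def S0_def mat_alg)
  finally have "L * B = L * (V * S + (E0 * S0 + Ui * (E0\<^sup>H * (Jmat n * B))))" by simp
  also have "\<dots> = L * (V * S) + L * (E0 * S0)"
    by (simp add: mult_add_dim mult2_eq_left[OF LUi] zero_mult_dim zero_add_dim)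
  finally have MV2: "M * V = L * (V * S) + L * (E0 * S0)" unfolding MV .
  have YLV: "Y * (L * V) = 0\<^sub>m l (2*nh)"
  proof -
    have "Y * (L * V) = E\<^sup>H * (Jmat n * V)" by (simp add: mult2_eq_left[OF E(3)] mult_assoc_dim)
    also have "\<dots> = 0\<^sub>m l (2*nh)" by (simp add: E_Ui adj_alg mult_assoc_dim UiV zero_mult_dim)
    finally show ?thesis .
  qed
  have YLE0: "Y * (L * E0) = - R\<^sup>H"
  proof -
    have "Y * (L * E0) = E\<^sup>H * (Jmat n * E0)" by (simp add: mult2_eq_left[OF E(3)] mult_assoc_dim)
    also have "\<dots> = - R\<^sup>H" by (simp add: E_Ui adj_alg mult_assoc_dim VU0 mat_alg)
    finally show ?thesis .
  qed
  \<comment> \<open>\<open>Y\<close> annihilates \<open>M * V\<close> and, as \<open>V\<close> is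
    orthogonal to the kernel of \<open>L\<close>, also \<open>L * V\<close>; what remains is the
    invertible \<open>R\<^sup>H\<close> times \<open>S0\<close>.\<close>
  have "S0 = 0\<^sub>m l (2*nh)"
  proof -
    have "Y * (M * V) = - (R\<^sup>H * S0)"
      unfolding MV2 by (simp add: mult_add_dim mult3_eq_left[OF YLV] mult3_eq_left[OF YLE0] mat_alg)
    moreover have "Y * (M * V) = 0\<^sub>m l (2*nh)"
      by (simp add: mult2_eq_left[OF sM(4)] zero_mult_dim)
    ultimately have RS: "R\<^sup>H * S0 = 0\<^sub>m l (2*nh)"
      by (metis uminus_uminus_mat add_uminus_dim(6))
    have RRH: "R'\<^sup>H * R\<^sup>H = 1\<^sub>m l" by (simp add: RR' flip: adjoint_mult_dim)
    have "R'\<^sup>H * (R\<^sup>H * S0) = 1\<^sub>m l * S0" by (rule mult2_eq_left[OF RRH]) simp_all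
    also have "\<dots> = S0" by (rule one_mult_dim) simp
    finally have "R'\<^sup>H * (R\<^sup>H * S0) = S0" .
    then show ?thesis unfolding RS by (simp add: zero_mult_dim)
  qed
  then have MVS: "M * V = L * (V * S)"
    using MV2 by (simp add: zero_mult_dim zero_add_dim)
  have "S * (Jmat nh * S\<^sup>H) = Jmat nh"
  proof -
    \<comment> \<open>A left inverse of \<open>L * V\<close>: \<open>D' * P'\<close> undoes
      \<open>L\<close> up to its kernel, to which \<open>V\<close> is orthogonal, and the Gram
      matrix of \<open>V\<close> squares to minus one.\<close>
    define X where "X = - (Jmat nh * (V\<^sup>H * (Jmat n * (D' * P'))))"
    have [simp]: "dim_row X = 2*nh" "dim_col X = 2*n" by (simp_all add: X_def)
    have "D' * (P' * (L * V)) = V - K' * (G' * V)"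
    proof -
      have "(D' * (P' * L) + K' * G') * V - K' * (G' * V) = D' * (P' * (L * V))"
        by (simp add: mat_alg)
      then show ?thesis unfolding sL(6) by (simp add: one_mult_dim)
    qed
    moreover have "V\<^sup>H * (Jmat n * (K' * (G' * V))) = 0\<^sub>m (2*nh) (2*nh)"
    proof -
      have VE: "V\<^sup>H * (Jmat n * E) = 0\<^sub>m (2*nh) l"
        by (simp add: E_Ui mult3_eq_left[OF VU0(2)] zero_mult_dim)
      have "K' * (G' * V) = E * (F * (K' * (G' * V)))"
        by (simp add: mult3_eq_left[OF K'[symmetric]])
      then have "V\<^sup>H * (Jmat n * (K' * (G' * V))) = V\<^sup>H * (Jmat n * (E * (F * (K' * (G' * V)))))"
        by (rule arg_cong)
      then show ?thesis by (simp add: mult3_eq_left[OF VE] zero_mult_dim)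
    qed
    ultimately have XLV: "X * (L * V) = 1\<^sub>m (2*nh)"
      by (simp add: X_def mat_alg VV Jmat_square)
    have XLVH: "V\<^sup>H * (L\<^sup>H * X\<^sup>H) = 1\<^sub>m (2*nh)"
      using XLV by (simp flip: adjoint_mult_dim add: mult_assoc_dim)
    \<comment> \<open>Each kernel term of \<open>T\<close> contains \<open>E0\<close> or its adjoint
      next to \<open>M\<close> or \<open>M\<^sup>H\<close>, so only the \<open>V\<close> term
      survives; for \<open>L\<close> the same happens with \<open>Ui\<close>.\<close>
    have "M * (T * M\<^sup>H) = (M * V) * (Jmat nh * (M * V)\<^sup>H)"
    proof -
      have "E0\<^sup>H * M\<^sup>H = 0\<^sub>m l (2*n)" using E0(1) by (simp flip: adjoint_mult_dim)
      then show ?thesis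
        by (simp add: T_def mat_alg adj_alg mult2_eq_left[OF E0(1)])
    qed
    moreover have "L * (T * L\<^sup>H) = (L * V) * (Jmat nh * (L * V)\<^sup>H)"
    proof -
      have "Ui\<^sup>H * L\<^sup>H = 0\<^sub>m l (2*n)" using LUi by (simp flip: adjoint_mult_dim)
      then show ?thesis
        by (simp add: T_def mat_alg adj_alg mult2_eq_left[OF LUi])
    qed
    ultimately have "(M * V) * (Jmat nh * (M * V)\<^sup>H) = (L * V) * (Jmat nh * (L * V)\<^sup>H)"
      using symp unfolding T by simp
    \<comment> \<open>Multiplying by \<open>X\<close> and its adjoint cancels \<open>L * V\<close>
      on both sides.\<close>
    then have "X * ((L * (V * S)) * (Jmat nh * (L * (V * S))\<^sup>H)) * X\<^sup>H =
        X * ((L * V) * (Jmat nh * (L * V)\<^sup>H)) * X\<^sup>H"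
      unfolding MVS by simp
    then show ?thesis
      by (simp add: adj_alg mult_assoc_dim mult3_eq_left[OF XLV] XLVH one_mult_dim)
  qed
  moreover have "S \<in> carrier_mat (2*nh) (2*nh)" by (rule carrier_matI) simp_all
  ultimately have sS: "symplectic_mat nh S"
    unfolding symplectic_mat_def by (simp add: mult_assoc_dim)
  have UQ: "U\<^sup>H * Jmat n * U = Q" using UU by (simp add: mult_assoc_dim)
  have MLS: "M * V = L * V * S" using MVS by (simp add: mult_assoc_dim)
  show ?thesis
  proof (intro exI[of _ nh] conjI, goal_cases)
    case 1
    show ?case by (rule ln(1))
  next
    case 2
    show ?case unfolding r(3) by (rule ln(3))
  next
    case 3
    show ?case unfolding r'(3) \<open>r' = r\<close> by (rule ln(3))
  next
    case 4
    show ?case unfolding Let_def ln(2)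
      by (rule exI[of _ E0], rule exI[of _ Ui], rule exI[of _ V], rule exI[of _ S])
        (intro conjI cU cV sS E0(1) LUi MLS UQ[unfolded U_def Q_def])
  qed
qed

end
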